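(* Let $d$ be any stable and homotopy invariant distance on $\mathbb{R}$-spaces. Then for all metric spaces $P$ and $Q$, $$d(\mathcal{R}(P),\mathcal{R}(Q))\leq d_{GH}(P,Q),$$ where $\mathcal{R}(\cdot)$ denotes the Vietoris–Rips filtration and $d_{GH}$ denotes the Gromov–Hausdorff distance.
   Context: $\mathbf{Top}$ is the category of compactly generated weakly Hausdorff (CGWH) spaces and continuous maps; all topological constructions are carried out in it. Regard $\mathbb{R}$ with its usual order as a category. An $\mathbb{R}$-space is a functor $X\colon\mathbb{R}\to\mathbf{Top}$, with spaces $X_r$ and internal maps $X_{r,s}\colon X_r\to X_s$ for $r\le s$; morphisms are natural transformations. Abstract simplicial complexes are regarded as spaces via geometric realization. A distance on $\mathbb{R}$-spaces is an extended pseudometric on the class of $\mathbb{R}$-spaces, i.e. a symmetric function $d$ with values in $[0,\infty]$ satisfying the triangle inequality and $d(X,X)=0$. Sublevelset filtration: for $T\in\mathbf{Top}$ and a (not necessarily continuous) function $\gamma\colon T\to\mathbb{R}$, $\mathcal{S}(\gamma)\colon\mathbb{R}\to\mathbf{Top}$ is given by $\mathcal{S}(\gamma)_r=\gamma^{-1}(-\infty,r]$ with the subspace topology (in the CGWH sense, i.e. the k-ification of the usual subspace topology) and internal maps the inclusions. For $\gamma,\kappa\colon T\to\mathbb{R}$, $d_\infty(\gamma,\kappa)=\sup_{x\in T}|\gamma(x)-\kappa(x)|$. Weak equivalence: a natural transformation $f\colon X\to Y$ of $\mathbb{R}$-spaces is an (objectwise) weak equivalence if each $f_r\colon X_r\to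 Y_r$ is a weak homotopy equivalence; $X\simeq Y$ means that $X$ and $Y$ are connected by a finite zigzag of objectwise weak equivalences. A distance $d$ on $\mathbb{R}$-spaces is stable if $d(\mathcal{S}(\gamma),\mathcal{S}(\kappa))\le d_\infty(\gamma,\kappa)$ for every $T\in\mathbf{Top}$ and all functions $\gamma,\kappa\colon T\to\mathbb{R}$. It is homotopy invariant if $d(X,Y)=0$ whenever $X\simeq Y$. Vietoris–Rips filtration: for a metric space $P$ with metric $d_P$, for $r\ge 0$, $\mathcal{R}(P)_r$ is the clique complex on the graph with vertex set $P$ and edges $[p,q]$ whenever $d_P(p,q)\le 2r$ (its simplices are the finite nonempty subsets of $P$ all of whose pairwise distances are at most $2r$); for $r<0$, $\mathcal{R}(P)_r=\emptyset$. A correspondence between sets $S$ and $T$ is a subset $C\subset S\times T$ whose coordinate projections to $S$ and to $T$ are surjective; $\Gamma(S,T)$ is the set of all of them. The Gromov–Hausdorff distance is $$d_{GH}(P,Q)=\tfrac12\inf_{C\in\Gamma(P,Q)}\ \sup_{(p,q),(p',q')\in C}|d_P(p,p')-d_Q(q,q')|.$$ *)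

theory Defs
  imports "HOL-Analysis.Analysis"
begin

section \<open>Compactly generated weakly Hausdorff spaces\<close>

text \<open>
  The test spaces of the CGWH formalism are all compact Hausdorff spaces, whereas a definition in
  HOL can only quantify over spaces with points in a fixed type.  For a space with points in
  \<open>'a\<close> it is enough to take test spaces with points in \<open>'a set set\<close>.
  For the weak Hausdorff property: given a continuous \<open>u\<close> on a compact Hausdorff \<open>K\<close>, choose
  one preimage of every point of the image; the closure \<open>L\<close> of the set \<open>D\<close> of these preimages
  has the same image as \<open>K\<close>, and \<open>L\<close> is a quotient of the Stone-Cech compactification of the
  discrete set \<open>D\<close>, so it has at most as many points as \<open>'a set set\<close>.
  For compact generation of a weakly Hausdorff space: the image of every test map is a compact
  Hausdorff subspace onto which the test map is a quotient map, so the inclusions of compact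
  Hausdorff subspaces already suffice.

  The library's \<^const>\<open>k_space\<close> and \<^const>\<open>kification\<close> use all (quasi-)compact subspaces as test
  spaces; without the Hausdorff property this is a different notion.
\<close>

definition test_map :: "'a set set topology \<Rightarrow> ('a set set \<Rightarrow> 'a) \<Rightarrow> 'a topology \<Rightarrow> bool" where
  "test_map K u X \<longleftrightarrow> compact_space K \<and> Hausdorff_space K \<and> continuous_map K X u"

definition k_open :: "'a topology \<Rightarrow> 'a set \<Rightarrow> bool" where
  "k_open X U \<longleftrightarrow> U \<subseteq> topspace X \<and>
     (\<forall>K u. test_map K u X \<longrightarrow> openin K {x \<in> topspace K. u x \<in> U})"

definition compactly_generated :: "'a topology \<Rightarrow> bool" where
  "compactly_generated X \<longleftrightarrow> (\<forall>U. k_open X U \<longrightarrow> openin X U)"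

definition weakly_Hausdorff :: "'a topology \<Rightarrow> bool" where
  "weakly_Hausdorff X \<longleftrightarrow> (\<forall>K u. test_map K u X \<longrightarrow> closedin X (u ` topspace K))"

definition CGWH :: "'a topology \<Rightarrow> bool" where
  "CGWH X \<longleftrightarrow> compactly_generated X \<and> weakly_Hausdorff X"

definition k_ify :: "'a topology \<Rightarrow> 'a topology" where
  "k_ify X = topology (k_open X)"

lemma openin_k_ify: "openin (k_ify X) U \<longleftrightarrow> k_open X U"
proof -
  have "istopology (k_open X)"
    unfolding istopology_def
  proof (intro conjI allI impI)
    fix S T assume S: "k_open X S" and T: "k_open X T"
    have "openin K {x \<in> topspace K. u x \<in> S \<inter> T}" if "test_map K u X" for K u
    proof -
      have "{x \<in> topspace K. u x \<in> S \<inter> T} =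
          {x \<in> topspace K. u x \<in> S} \<inter> {x \<in> topspace K. u x \<in> T}" by blast
      then show ?thesis using S T that by (simp add: k_open_def openin_Int)
    qed
    then show "k_open X (S \<inter> T)" using S by (auto simp: k_open_def)
  next
    fix \<K> assume \<K>: "\<forall>S\<in>\<K>. k_open X S"
    have "openin K {x \<in> topspace K. u x \<in> \<Union>\<K>}" if "test_map K u X" for K u
    proof -
      have "{x \<in> topspace K. u x \<in> \<Union>\<K>} = (\<Union>S\<in>\<K>. {x \<in> topspace K. u x \<in> S})" by blast
      then show ?thesis using \<K> that by (auto simp: k_open_def)
    qed
    then show "k_open X (\<Union>\<K>)" using \<K> by (auto simp: k_open_def)
  qed
  then show ?thesis by (simp add: k_ify_def)
qed

section \<open>\<open>\<real>\<close>-spaces\<close>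

text \<open>
  \<open>'a rspace\<close> represents functors from the ordered set of reals to CGWH spaces with points in
  \<open>'a\<close>.  Only \<open>rmap X r s\<close> for \<open>r \<le> s\<close>, and only its values on the points of \<open>rspc X r\<close>,
  are meaningful.  Representations that differ elsewhere are isomorphic via identity maps, so a
  homotopy invariant distance does not distinguish them.
\<close>

record 'a rspace =
  rspc :: "real \<Rightarrow> 'a topology"
  rmap :: "real \<Rightarrow> real \<Rightarrow> 'a \<Rightarrow> 'a"

definition is_rspace :: "'a rspace \<Rightarrow> bool" where
  "is_rspace X \<longleftrightarrow>
     (\<forall>r. CGWH (rspc X r)) \<and>
     (\<forall>r s. r \<le> s \<longrightarrow> continuous_map (rspc X r) (rspc X s) (rmap X r s)) \<and>
     (\<forall>r. \<forall>x\<in>topspace (rspc X r). rmap X r r x = x) \<and>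
     (\<forall>r s t. r \<le> s \<longrightarrow> s \<le> t \<longrightarrow>
        (\<forall>x\<in>topspace (rspc X r). rmap X s t (rmap X r s x) = rmap X r t x))"

definition nat_trans :: "'a rspace \<Rightarrow> 'b rspace \<Rightarrow> (real \<Rightarrow> 'a \<Rightarrow> 'b) \<Rightarrow> bool" where
  "nat_trans X Y f \<longleftrightarrow>
     (\<forall>r. continuous_map (rspc X r) (rspc Y r) (f r)) \<and>
     (\<forall>r s. r \<le> s \<longrightarrow>
        (\<forall>x\<in>topspace (rspc X r). f s (rmap X r s x) = rmap Y r s (f r x)))"

section \<open>Weak equivalences\<close>

definition cube :: "nat \<Rightarrow> (nat \<Rightarrow> real) topology" where
  "cube n = product_topology (\<lambda>_. top_of_set {0..1}) {..<n}"

definition cube_boundary :: "nat \<Rightarrow> (nat \<Rightarrow> real) set" where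
  "cube_boundary n = {z \<in> topspace (cube n). \<exists>i<n. z i = 0 \<or> z i = 1}"

definition spheroids :: "nat \<Rightarrow> 'a topology \<Rightarrow> 'a \<Rightarrow> ((nat \<Rightarrow> real) \<Rightarrow> 'a) set" where
  "spheroids n X x = {p. continuous_map (cube n) X p \<and> p ` cube_boundary n \<subseteq> {x}}"

definition spheroid_homotopic ::
  "nat \<Rightarrow> 'a topology \<Rightarrow> 'a \<Rightarrow> ((nat \<Rightarrow> real) \<Rightarrow> 'a) \<Rightarrow> ((nat \<Rightarrow> real) \<Rightarrow> 'a) \<Rightarrow> bool" where
  "spheroid_homotopic n X x = homotopic_with (\<lambda>p. p ` cube_boundary n \<subseteq> {x}) (cube n) X"

text \<open>The underlying set of the \<open>n\<close>-th homotopy group, for \<open>n \<ge> 1\<close>.\<close>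

definition homotopy_classes :: "nat \<Rightarrow> 'a topology \<Rightarrow> 'a \<Rightarrow> ((nat \<Rightarrow> real) \<Rightarrow> 'a) set set" where
  "homotopy_classes n X x = spheroids n X x // {(p, q). spheroid_homotopic n X x p q}"

definition induced_homotopy ::
  "nat \<Rightarrow> 'b topology \<Rightarrow> 'b \<Rightarrow> ('a \<Rightarrow> 'b) \<Rightarrow> ((nat \<Rightarrow> real) \<Rightarrow> 'a) set \<Rightarrow> ((nat \<Rightarrow> real) \<Rightarrow> 'b) set" where
  "induced_homotopy n Y y f c = {q. \<exists>p\<in>c. spheroid_homotopic n Y y (f \<circ> p) q}"

definition induced_path_component :: "'b topology \<Rightarrow> ('a \<Rightarrow> 'b) \<Rightarrow> 'a set \<Rightarrow> 'b set" where
  "induced_path_component Y f C = {y. \<exists>x\<in>C. path_component_of Y (f x) y}"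

text \<open>
  The map induced on homotopy groups is a homomorphism for every continuous \<open>f\<close>, so being an
  isomorphism is the same as being bijective, and the group structure need not be mentioned.
\<close>

definition weak_homotopy_equivalence :: "'a topology \<Rightarrow> 'b topology \<Rightarrow> ('a \<Rightarrow> 'b) \<Rightarrow> bool" where
  "weak_homotopy_equivalence X Y f \<longleftrightarrow>
     continuous_map X Y f \<and>
     bij_betw (induced_path_component Y f) (path_components_of X) (path_components_of Y) \<and>
     (\<forall>n\<ge>1. \<forall>x\<in>topspace X.
        bij_betw (induced_homotopy n Y (f x) f) (homotopy_classes n X x) (homotopy_classes n Y (f x)))"

definition weakly_equivalent_step :: "'a rspace \<Rightarrow> 'a rspace \<Rightarrow> bool" where
  "weakly_equivalent_step X Y \<longleftrightarrow> is_rspace X \<and> is_rspace Y \<and>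
     (\<exists>f. nat_trans X Y f \<and> (\<forall>r. weak_homotopy_equivalence (rspc X r) (rspc Y r) (f r)))"

definition weakly_equivalent :: "'a rspace \<Rightarrow> 'a rspace \<Rightarrow> bool" where
  "weakly_equivalent = equivclp weakly_equivalent_step"

section \<open>Distances on \<open>\<real>\<close>-spaces\<close>

text \<open>
  A distance on the class of all \<open>\<real>\<close>-spaces restricts to one on the \<open>\<real>\<close>-spaces with points in
  a given type \<open>'a\<close>, and the restriction inherits stability and homotopy invariance (below, \<open>T\<close> and
  the intermediate terms of the zigzags range over spaces with points in \<open>'a\<close> only, so less is
  required).  Realizations of complexes with vertices in \<open>'v\<close> have their points in \<open>'v \<Rightarrow> real\<close>,
  and any two metric spaces embed in a common type \<open>'v\<close>, such as a sum type.  So a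
  bound on \<open>d (rips P) (rips Q)\<close> for all distances at \<open>'a = ('v \<Rightarrow> real)\<close>, for arbitrary \<open>'v\<close>,
  covers all distances on the class of all \<open>\<real>\<close>-spaces and all metric spaces.
\<close>

definition rspace_distance :: "('a rspace \<Rightarrow> 'a rspace \<Rightarrow> ennreal) \<Rightarrow> bool" where
  "rspace_distance d \<longleftrightarrow>
     (\<forall>X. is_rspace X \<longrightarrow> d X X = 0) \<and>
     (\<forall>X Y. is_rspace X \<longrightarrow> is_rspace Y \<longrightarrow> d X Y = d Y X) \<and>
     (\<forall>X Y Z. is_rspace X \<longrightarrow> is_rspace Y \<longrightarrow> is_rspace Z \<longrightarrow> d X Z \<le> d X Y + d Y Z)"

definition sublevel :: "'a topology \<Rightarrow> ('a \<Rightarrow> real) \<Rightarrow> 'a rspace" where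
  "sublevel T \<gamma> =
     \<lparr>rspc = (\<lambda>r. k_ify (subtopology T {x \<in> topspace T. \<gamma> x \<le> r})), rmap = (\<lambda>r s x. x)\<rparr>"

definition sup_dist :: "'a topology \<Rightarrow> ('a \<Rightarrow> real) \<Rightarrow> ('a \<Rightarrow> real) \<Rightarrow> ennreal" where
  "sup_dist T \<gamma> \<kappa> = (SUP x\<in>topspace T. ennreal \<bar>\<gamma> x - \<kappa> x\<bar>)"

definition stable_distance :: "('a rspace \<Rightarrow> 'a rspace \<Rightarrow> ennreal) \<Rightarrow> bool" where
  "stable_distance d \<longleftrightarrow>
     (\<forall>T \<gamma> \<kappa>. CGWH T \<longrightarrow> d (sublevel T \<gamma>) (sublevel T \<kappa>) \<le> sup_dist T \<gamma> \<kappa>)"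

definition homotopy_invariant :: "('a rspace \<Rightarrow> 'a rspace \<Rightarrow> ennreal) \<Rightarrow> bool" where
  "homotopy_invariant d \<longleftrightarrow>
     (\<forall>X Y. is_rspace X \<longrightarrow> is_rspace Y \<longrightarrow> weakly_equivalent X Y \<longrightarrow> d X Y = 0)"

section \<open>Geometric realization and the Vietoris--Rips filtration\<close>

text \<open>
  A simplicial complex is given by its set of simplices (finite nonempty vertex sets), a point of
  its realization by the barycentric coordinates.  The product topology on \<open>'v \<Rightarrow> real\<close> induces
  the Euclidean topology on each closed simplex, and the realization carries the coherent (weak)
  topology with respect to the closed simplices.
\<close>

definition closed_simplex :: "'v set \<Rightarrow> ('v \<Rightarrow> real) set" where
  "closed_simplex \<sigma> = {a. (\<forall>v. 0 \<le> a v) \<and> (\<forall>v. v \<notin> \<sigma> \<longrightarrow> a v = 0) \<and> (\<Sum>v\<in>\<sigma>. a v) = 1}"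

definition realization_open :: "'v set set \<Rightarrow> ('v \<Rightarrow> real) set \<Rightarrow> bool" where
  "realization_open \<K> U \<longleftrightarrow> U \<subseteq> (\<Union>\<sigma>\<in>\<K>. closed_simplex \<sigma>) \<and>
     (\<forall>\<sigma>\<in>\<K>. openin (top_of_set (closed_simplex \<sigma>)) (closed_simplex \<sigma> \<inter> U))"

definition realization :: "'v set set \<Rightarrow> ('v \<Rightarrow> real) topology" where
  "realization \<K> = topology (realization_open \<K>)"

lemma openin_realization: "openin (realization \<K>) U \<longleftrightarrow> realization_open \<K> U"
proof -
  have "istopology (realization_open \<K>)"
    unfolding istopology_def
  proof (intro conjI allI impI)
    fix S T assume S: "realization_open \<K> S" and T: "realization_open \<K> T"
    have "openin (top_of_set (closed_simplex \<sigma>)) (closed_simplex \<sigma> \<inter> (S \<inter> T))"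
      if "\<sigma> \<in> \<K>" for \<sigma>
    proof -
      have "closed_simplex \<sigma> \<inter> (S \<inter> T) = (closed_simplex \<sigma> \<inter> S) \<inter> (closed_simplex \<sigma> \<inter> T)" by blast
      then show ?thesis using S T that unfolding realization_open_def by (metis openin_Int)
    qed
    then show "realization_open \<K> (S \<inter> T)" using S unfolding realization_open_def by blast
  next
    fix \<U> assume \<U>: "\<forall>S\<in>\<U>. realization_open \<K> S"
    have "openin (top_of_set (closed_simplex \<sigma>)) (closed_simplex \<sigma> \<inter> \<Union>\<U>)"
      if "\<sigma> \<in> \<K>" for \<sigma>
    proof -
      have "closed_simplex \<sigma> \<inter> \<Union>\<U> = \<Union>((\<lambda>S. closed_simplex \<sigma> \<inter> S) ` \<U>)" by blast
      moreover have "openin (top_of_set (closed_simplex \<sigma>)) (\<Union>((\<lambda>S. closed_simplex \<sigma> \<inter> S) ` \<U>))"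
        by (rule openin_Union) (use \<U> that in \<open>auto simp: realization_open_def\<close>)
      ultimately show ?thesis by simp
    qed
    then show "realization_open \<K> (\<Union>\<U>)" using \<U> unfolding realization_open_def by blast
  qed
  then show ?thesis by (simp add: realization_def)
qed

definition rips_complex :: "'v metric \<Rightarrow> real \<Rightarrow> 'v set set" where
  "rips_complex P r =
     (if r < 0 then {}
      else {\<sigma>. finite \<sigma> \<and> \<sigma> \<noteq> {} \<and> \<sigma> \<subseteq> mspace P \<and> (\<forall>p\<in>\<sigma>. \<forall>q\<in>\<sigma>. mdist P p q \<le> 2 * r)})"

definition rips :: "'v metric \<Rightarrow> ('v \<Rightarrow> real) rspace" where
  "rips P = \<lparr>rspc = (\<lambda>r. realization (rips_complex P r)), rmap = (\<lambda>r s x. x)\<rparr>"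

section \<open>Gromov--Hausdorff distance\<close>

definition correspondences :: "'a set \<Rightarrow> 'b set \<Rightarrow> ('a \<times> 'b) set set" where
  "correspondences S T = {C. C \<subseteq> S \<times> T \<and> fst ` C = S \<and> snd ` C = T}"

definition d_GH :: "'a metric \<Rightarrow> 'b metric \<Rightarrow> ennreal" where
  "d_GH P Q =
     (INF C\<in>correspondences (mspace P) (mspace Q).
        SUP ((p, q), (p', q'))\<in>C \<times> C. ennreal \<bar>mdist P p p' - mdist Q q q'\<bar>) / 2"

end

theory Submission
  imports Defs
begin

text \<open>
  A correspondence \<open>C\<close> carries two functions on the realization \<open>T\<close> of the full simplex on \<open>C\<close>: half
  the diameter in \<open>P\<close>, respectively in \<open>Q\<close>, of the support of a point projected to that space.  They
  differ by at most half the distortion of \<open>C\<close>.  The sublevel set at \<open>r\<close> of the first one is the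
  subcomplex of all \<open>\<sigma> \<subseteq> C\<close> that project to a simplex of the Vietoris--Rips complex of \<open>P\<close>.  A section
  \<open>s\<close> of the projection \<open>C \<rightarrow> P\<close>, chosen independently of \<open>r\<close>, embeds the Vietoris--Rips complex into
  it as a strong deformation retract, because \<open>s \<circ> fst\<close> and the identity are contiguous.  So both
  sublevel filtrations are weakly equivalent to Vietoris--Rips filtrations, and stability on \<open>T\<close>
  gives the bound.
\<close>

section \<open>Strong deformation retracts and weak equivalences\<close>

lemma cube_boundary_subset: "cube_boundary n \<subseteq> topspace (cube n)"
  by (auto simp: cube_boundary_def)

section \<open>Homotopies of spheroids relative to the boundary of the cube\<close>

lemma spheroid_homotopic_refl:
  "p \<in> spheroids n X x \<Longrightarrow> spheroid_homotopic n X x p p"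
  by (simp add: spheroids_def spheroid_homotopic_def)

lemma spheroid_homotopic_sym:
  "spheroid_homotopic n X x p q \<Longrightarrow> spheroid_homotopic n X x q p"
  unfolding spheroid_homotopic_def by (rule homotopic_with_symD)

lemma spheroid_homotopic_trans:
  "spheroid_homotopic n X x p q \<Longrightarrow> spheroid_homotopic n X x q r \<Longrightarrow> spheroid_homotopic n X x p r"
  unfolding spheroid_homotopic_def by (rule homotopic_with_trans)

lemma spheroid_homotopic_class_eq:
  "spheroid_homotopic n X x p q \<Longrightarrow>
    {r. spheroid_homotopic n X x p r} = {r. spheroid_homotopic n X x q r}"
  by (blast intro: spheroid_homotopic_sym spheroid_homotopic_trans)

lemma spheroids_compose:
  "continuous_map X Y f \<Longrightarrow> p \<in> spheroids n X x \<Longrightarrow> f \<circ> p \<in> spheroids n Y (f x)"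
  by (auto simp: spheroids_def image_subset_iff intro: continuous_map_compose)

lemma spheroid_homotopic_compose:
  assumes "continuous_map X Y f" "spheroid_homotopic n X x p q"
  shows "spheroid_homotopic n Y (f x) (f \<circ> p) (f \<circ> q)"
  using assms(2) unfolding spheroid_homotopic_def
  by (rule homotopic_with_compose_continuous_map_left [OF _ assms(1)]) (auto simp: image_subset_iff)

lemma homotopy_classes_eq:
  "homotopy_classes n X x = (\<lambda>p. {q. spheroid_homotopic n X x p q}) ` spheroids n X x"
  by (auto simp: homotopy_classes_def quotient_def Image_def)

text \<open>\<open>induced_homotopy\<close> is a union over all members of a class. It collapses to
  a single class because composition with \<open>f\<close> preserves homotopies relative to the
  boundary.\<close>

lemma induced_homotopy_class:
  assumes f: "continuous_map X Y f" and p: "p \<in> spheroids n X x"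
  shows "induced_homotopy n Y (f x) f {q. spheroid_homotopic n X x p q} =
    {q. spheroid_homotopic n Y (f x) (f \<circ> p) q}"
  using spheroid_homotopic_refl [OF p]
  by (auto simp: induced_homotopy_def intro: spheroid_homotopic_trans spheroid_homotopic_compose [OF f])

text \<open>Since the homotopy fixes the image of \<open>f\<close>, no change of base point is needed.\<close>

lemma weak_homotopy_equivalence_strong_deformation_retract:
  assumes f: "continuous_map X Y f" and g: "continuous_map Y X g"
    and gf: "\<And>x. x \<in> topspace X \<Longrightarrow> g (f x) = x"
    and H: "continuous_map (prod_topology (top_of_set {0..1::real}) Y) Y H"
    and H0: "\<And>y. y \<in> topspace Y \<Longrightarrow> H (0, y) = f (g y)"
    and H1: "\<And>y. y \<in> topspace Y \<Longrightarrow> H (1, y) = y"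
    and Hf: "\<And>t x. t \<in> {0..1} \<Longrightarrow> x \<in> topspace X \<Longrightarrow> H (t, f x) = f x"
  shows "weak_homotopy_equivalence X Y f"
  unfolding weak_homotopy_equivalence_def
proof (intro conjI allI impI ballI)
  show "continuous_map X Y f" by fact
next
  have fin: "f x \<in> topspace Y" if "x \<in> topspace X" for x
    using f that by (simp add: continuous_map_def Pi_iff)
  have gin: "g y \<in> topspace X" if "y \<in> topspace Y" for y
    using g that by (simp add: continuous_map_def Pi_iff)
  have path_f: "path_component_of Y (f x) (f x')" if "path_component_of X x x'" for x x'
    using f that by (rule path_component_of_continuous_image)
  have path_g: "path_component_of X (g y) (g y')" if "path_component_of Y y y'" for y y'
    using g that by (rule path_component_of_continuous_image)
  \<comment> \<open>The track of \<open>y\<close> under \<open>H\<close> is a path from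
    \<open>f (g y)\<close> to \<open>y\<close>.\<close>
  have path_H: "path_component_of Y (f (g y)) y" if "y \<in> topspace Y" for y
    unfolding path_component_of_def pathin_def
  proof (intro exI conjI)
    show "continuous_map (top_of_set {0..1}) Y (\<lambda>t. H (t, y))"
      using continuous_map_compose [OF _ H, of "top_of_set {0..1}" "\<lambda>t. (t, y)"] that
      by (simp add: o_def continuous_map_pairwise)
  qed (use H0 H1 that in auto)
  have ind: "induced_path_component Y f {x'. path_component_of X x x'} = {y. path_component_of Y (f x) y}"
    if "x \<in> topspace X" for x
  proof
    show "induced_path_component Y f {x'. path_component_of X x x'} \<subseteq> {y. path_component_of Y (f x) y}"
      using path_f path_component_of_trans by (fastforce simp: induced_path_component_def)
    show "{y. path_component_of Y (f x) y} \<subseteq> induced_path_component Y f {x'. path_component_of X x x'}"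
      using that path_component_of_refl [of X x] by (auto simp: induced_path_component_def)
  qed
  have comps: "path_components_of Z = (\<lambda>z. {z'. path_component_of Z z z'}) ` topspace Z" for Z :: "'c topology"
    by (auto simp: path_components_of_def)
  show "bij_betw (induced_path_component Y f) (path_components_of X) (path_components_of Y)"
    unfolding bij_betw_def
  proof
    show "inj_on (induced_path_component Y f) (path_components_of X)"
    proof (rule inj_onI, unfold comps, clarify)
      fix x x'
      assume x: "x \<in> topspace X" "x' \<in> topspace X"
        and "induced_path_component Y f {z. path_component_of X x z} =
          induced_path_component Y f {z. path_component_of X x' z}"
      then have "path_component_of Y (f x) (f x')"
        using fin [of x'] path_component_of_refl [of Y "f x'"] by (simp add: ind set_eq_iff)
      \<comment> \<open>Applying \<open>g\<close> to a path from \<open>f x\<close> to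
        \<open>f x'\<close> gives a path from \<open>x\<close> to \<open>x'\<close>.\<close>
      then have "path_component_of X x x'"
        using path_g [of "f x" "f x'"] x gf by simp
      then show "{z. path_component_of X x z} = {z. path_component_of X x' z}"
        by (blast intro: path_component_of_trans path_component_of_sym)
    qed
    show "induced_path_component Y f ` path_components_of X = path_components_of Y"
    proof (unfold comps image_image, intro equalityI subsetI; clarify)
      fix x assume "x \<in> topspace X"
      then show "induced_path_component Y f {z. path_component_of X x z} \<in>
          (\<lambda>z. {z'. path_component_of Y z z'}) ` topspace Y"
        using ind fin by auto
    next
      fix y assume y: "y \<in> topspace Y"
      have "{z. path_component_of Y y z} = {z. path_component_of Y (f (g y)) z}"
        using path_H [OF y] by (blast intro: path_component_of_trans path_component_of_sym)
      then show "{z. path_component_of Y y z} \<in>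
          (\<lambda>x. induced_path_component Y f {z. path_component_of X x z}) ` topspace X"
        using ind gin y by auto
    qed
  qed
next
  fix n :: nat and x assume x: "x \<in> topspace X"
  have g': "p \<in> spheroids n Y (f x) \<Longrightarrow> g \<circ> p \<in> spheroids n X x" for p
    using spheroids_compose [OF g, of p n "f x"] gf [OF x] by simp
  \<comment> \<open>\<open>g \<circ> f\<close> is the identity only on \<open>topspace X\<close>, so
    the two total functions agree only on the cube. They are therefore homotopic rather than
    equal.\<close>
  have gf': "spheroid_homotopic n X x (g \<circ> (f \<circ> p)) p" if p: "p \<in> spheroids n X x" for p
    unfolding spheroid_homotopic_def
  proof (rule homotopic_with_symD, rule homotopic_with_equal)
    show cp: "continuous_map (cube n) X p" and b: "p ` cube_boundary n \<subseteq> {x}"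
      using p by (auto simp: spheroids_def)
    show "p z = (g \<circ> (f \<circ> p)) z" if "z \<in> topspace (cube n)" for z
    proof -
      have "p z \<in> topspace X" using cp that by (simp add: continuous_map_def Pi_iff)
      then show ?thesis by (simp add: gf)
    qed
    show "(g \<circ> (f \<circ> p)) ` cube_boundary n \<subseteq> {x}" using b gf [OF x] by auto
  qed
  \<comment> \<open>Following \<open>q\<close> by \<open>H\<close> gives the homotopy. The boundary
    goes to \<open>f x\<close>, where \<open>H\<close> is stationary, so the homotopy is relative to
    the boundary.\<close>
  have fg': "spheroid_homotopic n Y (f x) (f \<circ> (g \<circ> q)) q" if q: "q \<in> spheroids n Y (f x)" for q
  proof -
    have cq: "continuous_map (cube n) Y q" and bq: "q ` cube_boundary n \<subseteq> {f x}"
      using q by (auto simp: spheroids_def)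
    have qin: "q z \<in> topspace Y" if "z \<in> topspace (cube n)" for z
      using cq that by (simp add: continuous_map_def Pi_iff)
    have "continuous_map (prod_topology (top_of_set {0..1::real}) (cube n)) 
            (prod_topology (top_of_set {0..1::real}) Y) (\<lambda>z. (fst z, q (snd z)))"
      using continuous_map_compose [OF continuous_map_snd cq]
      by (auto simp: continuous_map_pairwise o_def continuous_map_fst)
    from continuous_map_compose [OF this H]
    have c: "continuous_map (prod_topology (top_of_set {0..1::real}) (cube n)) Y (\<lambda>z. H (fst z, q (snd z)))"
      by (simp add: o_def)
    have "homotopic_with (\<lambda>p. p ` cube_boundary n \<subseteq> {f x}) (cube n) Y (f \<circ> (g \<circ> q)) q"
    \<comment> \<open>The unfolding asks that the side condition depend only on values on the cube.
      It does, since the boundary lies in the cube.\<close>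
    proof (subst homotopic_with)
      fix h k :: "(nat \<Rightarrow> real) \<Rightarrow> 'b"
      assume "\<And>z. z \<in> topspace (cube n) \<Longrightarrow> h z = k z"
      then show "(h ` cube_boundary n \<subseteq> {f x}) = (k ` cube_boundary n \<subseteq> {f x})"
        using cube_boundary_subset [of n] by (force simp: image_subset_iff)
    next
      show "\<exists>h. continuous_map (prod_topology (top_of_set {0..1::real}) (cube n)) Y h \<and>
        (\<forall>z\<in>topspace (cube n). h (0, z) = (f \<circ> (g \<circ> q)) z) \<and>
        (\<forall>z\<in>topspace (cube n). h (1, z) = q z) \<and>
        (\<forall>t\<in>{0..1}. (\<lambda>z. h (t, z)) ` cube_boundary n \<subseteq> {f x})"
        using c qin bq H0 H1 Hf [OF _ x] by - (rule exI [of _ "\<lambda>z. H (fst z, q (snd z))"], auto simp: image_subset_iff)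
    qed
    then show ?thesis by (simp add: spheroid_homotopic_def)
  qed
  show "bij_betw (induced_homotopy n Y (f x) f) (homotopy_classes n X x) (homotopy_classes n Y (f x))"
    unfolding bij_betw_def
  proof
    show "inj_on (induced_homotopy n Y (f x) f) (homotopy_classes n X x)"
    proof (rule inj_onI, unfold homotopy_classes_eq, clarify)
      fix p q assume pq: "p \<in> spheroids n X x" "q \<in> spheroids n X x"
        and "induced_homotopy n Y (f x) f {r. spheroid_homotopic n X x p r} =
          induced_homotopy n Y (f x) f {r. spheroid_homotopic n X x q r}"
      then have "spheroid_homotopic n Y (f x) (f \<circ> p) (f \<circ> q)"
        using spheroid_homotopic_refl [OF spheroids_compose [OF f pq(2)]]
        by (auto simp: induced_homotopy_class [OF f])
      \<comment> \<open>Injectivity: apply \<open>g\<close> to the homotopy and cancel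
        \<open>g \<circ> f\<close>.\<close>
      then have "spheroid_homotopic n X x (g \<circ> (f \<circ> p)) (g \<circ> (f \<circ> q))"
        using spheroid_homotopic_compose [OF g, of n "f x" "f \<circ> p" "f \<circ> q"] gf [OF x] by simp
      then have "spheroid_homotopic n X x p q"
        using gf' pq by (blast intro: spheroid_homotopic_sym spheroid_homotopic_trans)
      then show "{r. spheroid_homotopic n X x p r} = {r. spheroid_homotopic n X x q r}"
        by (rule spheroid_homotopic_class_eq)
    qed
    show "induced_homotopy n Y (f x) f ` homotopy_classes n X x = homotopy_classes n Y (f x)"
    proof (unfold homotopy_classes_eq image_image, intro equalityI subsetI; clarify)
      fix p assume "p \<in> spheroids n X x"
      then show "induced_homotopy n Y (f x) f {q. spheroid_homotopic n X x p q} \<in>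
          (\<lambda>p. {q. spheroid_homotopic n Y (f x) p q}) ` spheroids n Y (f x)"
        using spheroids_compose [OF f] by (simp add: induced_homotopy_class [OF f])
    next
      fix q assume q: "q \<in> spheroids n Y (f x)"
      \<comment> \<open>Surjectivity: the class of \<open>q\<close> comes from the class of
        \<open>g \<circ> q\<close>.\<close>
      have "{r. spheroid_homotopic n Y (f x) q r} = induced_homotopy n Y (f x) f {r. spheroid_homotopic n X x (g \<circ> q) r}"
        using spheroid_homotopic_class_eq [OF fg' [OF q]] g' [OF q] by (simp add: induced_homotopy_class [OF f])
      then show "{r. spheroid_homotopic n Y (f x) q r} \<in>
          (\<lambda>p. induced_homotopy n Y (f x) f {q. spheroid_homotopic n X x p q}) ` spheroids n X x"
        using g' [OF q] by blast
    qed
  qed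
qed

section \<open>Hausdorff k-spaces\<close>

text \<open>Test spaces must have points in \<open>'a set set\<close>, so \<open>C\<close> is copied
  there by \<open>x \<mapsto> {{x}}\<close>, and \<open>u\<close> is the inverse of this copy. Every
  compact subspace of a Hausdorff space thus counts as a test space.\<close>

lemma test_map_subtopology:
  assumes "Hausdorff_space X" "compactin X C"
  shows "\<exists>K u. test_map K u X \<and>
    (\<forall>U. openin K {x \<in> topspace K. u x \<in> U} \<longrightarrow> openin (subtopology X C) (C \<inter> U))"
proof (intro exI conjI allI impI)
  let ?e = "\<lambda>x :: 'a. {{x}}" and ?u = "\<lambda>z :: 'a set set. the_elem (the_elem z)"
  let ?K = "pullback_topology (?e ` C) ?u (subtopology X C)"
  have C: "C \<subseteq> topspace X" using assms(2) by (rule compactin_subset_topspace)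
  have topK: "topspace ?K = ?e ` C"
    using C by (auto simp: topspace_pullback_topology)
  have cu: "continuous_map ?K (subtopology X C) ?u"
    using continuous_map_pullback [OF continuous_map_id, of "?e ` C" ?u "subtopology X C"]
    by (simp add: o_def id_def)
  have ce: "continuous_map (subtopology X C) ?K ?e"
    by (rule continuous_map_pullback') (use C in \<open>auto simp: o_def\<close>)
  have hom: "homeomorphic_maps ?K (subtopology X C) ?u ?e"
    using cu ce by (auto simp: homeomorphic_maps_def topK)
  then have hs: "?K homeomorphic_space subtopology X C"
    by (rule homeomorphic_maps_imp_homeomorphic_space)
  have "compact_space ?K"
    by (simp add: homeomorphic_compact_space [OF hs] assms(2) compact_space_subtopology)
  moreover have "Hausdorff_space ?K"
    by (simp add: homeomorphic_Hausdorff_space [OF hs] assms(1) Hausdorff_space_subtopology)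
  ultimately show "test_map ?K ?u X"
    using cu by (simp add: test_map_def continuous_map_in_subtopology)
  fix U assume "openin ?K {x \<in> topspace ?K. ?u x \<in> U}"
  from openin_continuous_map_preimage [OF ce this]
  have "openin (subtopology X C) {x \<in> topspace (subtopology X C). ?e x \<in> {x \<in> topspace ?K. ?u x \<in> U}}" .
  moreover have "{x \<in> topspace (subtopology X C). ?e x \<in> {x \<in> topspace ?K. ?u x \<in> U}} = C \<inter> U"
    using C by (auto simp: topK)
  ultimately show "openin (subtopology X C) (C \<inter> U)" by simp
qed

text \<open>Bridge from openness tested by compact Hausdorff spaces to \<open>k_space\<close>, which
  tests by compact subspaces. In a Hausdorff space these subspaces are Hausdorff, so both tests
  agree.\<close>

lemma k_open_iff_openin:
  assumes "Hausdorff_space X" "k_space X"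
  shows "k_open X U \<longleftrightarrow> openin X U"
proof
  assume U: "k_open X U"
  have "openin (subtopology X C) (C \<inter> U)" if C: "compactin X C" for C
  proof -
    obtain K u where "test_map K u X"
      and *: "\<And>U. openin K {x \<in> topspace K. u x \<in> U} \<Longrightarrow> openin (subtopology X C) (C \<inter> U)"
      using test_map_subtopology [OF assms(1) C] by blast
    then show ?thesis using U unfolding k_open_def by blast
  qed
  then show "openin X U"
    using assms(2) U unfolding k_space_open k_open_def by blast
next
  assume U: "openin X U"
  have "openin K {x \<in> topspace K. u x \<in> U}" if "test_map K u X" for K u
    using that U unfolding test_map_def by (blast intro: openin_continuous_map_preimage)
  then show "k_open X U"
    using openin_subset [OF U] by (simp add: k_open_def)
qed

text \<open>The image under a test map is compact, hence closed in a Hausdorff space.\<close>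

lemma CGWH_if_Hausdorff_k_space:
  assumes "Hausdorff_space X" "k_space X"
  shows "CGWH X"
proof -
  have "closedin X (u ` topspace K)" if "test_map K u X" for K u
    using that assms(1) unfolding test_map_def compact_space_def
    by (blast intro: compactin_imp_closedin image_compactin)
  then show ?thesis
    using k_open_iff_openin [OF assms] by (simp add: CGWH_def compactly_generated_def weakly_Hausdorff_def)
qed

lemma k_ify_eq:
  assumes "Hausdorff_space X" "k_space X"
  shows "k_ify X = X"
  using k_open_iff_openin [OF assms] by (simp add: topology_eq openin_k_ify)

section \<open>The topology of the realization\<close>

lemma topspace_realization: "topspace (realization \<K>) = (\<Union>\<sigma>\<in>\<K>. closed_simplex \<sigma>)"
proof
  show "topspace (realization \<K>) \<subseteq> (\<Union>\<sigma>\<in>\<K>. closed_simplex \<sigma>)"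
    using openin_topspace [of "realization \<K>"] unfolding openin_realization realization_open_def by (rule conjunct1)
  have "closed_simplex \<sigma> \<inter> (\<Union>\<sigma>\<in>\<K>. closed_simplex \<sigma>) = closed_simplex \<sigma>" if "\<sigma> \<in> \<K>" for \<sigma>
    using that by blast
  then have "openin (realization \<K>) (\<Union>\<sigma>\<in>\<K>. closed_simplex \<sigma>)"
    by (simp add: openin_realization realization_open_def)
  then show "(\<Union>\<sigma>\<in>\<K>. closed_simplex \<sigma>) \<subseteq> topspace (realization \<K>)"
    by (rule openin_subset)
qed

lemma closed_closed_simplex: "closed (closed_simplex \<sigma>)"
proof -
  have eq: "closed_simplex \<sigma> = (\<Inter>v. {a. 0 \<le> a v}) \<inter> (\<Inter>v\<in>- \<sigma>. {a. a v = 0}) \<inter> {a. (\<Sum>v\<in>\<sigma>. a v) = 1}"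
    by (auto simp: closed_simplex_def)
  show ?thesis
    unfolding eq
    by (intro closed_Int closed_INT ballI closed_Collect_le closed_Collect_eq continuous_intros
        continuous_on_product_coordinates)
qed

text \<open>A sum over an infinite set is 0 by convention and so never 1. Infinite vertex sets
  therefore span an empty closed simplex.\<close>

lemma closed_simplex_finite: "a \<in> closed_simplex \<sigma> \<Longrightarrow> finite \<sigma>"
  using sum.infinite by (fastforce simp: closed_simplex_def)

lemma closed_simplex_nonempty: "a \<in> closed_simplex \<sigma> \<Longrightarrow> \<sigma> \<noteq> {}"
  by (auto simp: closed_simplex_def)

text \<open>Coordinates outside \<open>\<tau>\<close> vanish, so dropping them from the sum over
  \<open>\<sigma>\<close> keeps it equal to 1.\<close>

lemma closed_simplex_Int:
  assumes "a \<in> closed_simplex \<sigma>" "a \<in> closed_simplex \<tau>"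
  shows "a \<in> closed_simplex (\<sigma> \<inter> \<tau>)"
proof -
  have "(\<Sum>v\<in>\<sigma> \<inter> \<tau>. a v) = (\<Sum>v\<in>\<sigma>. a v)"
    using assms closed_simplex_finite [OF assms(1)]
    by (intro sum.mono_neutral_left) (auto simp: closed_simplex_def)
  then show ?thesis
    using assms by (auto simp: closed_simplex_def)
qed

lemma closed_simplex_mono:
  assumes "\<sigma> \<subseteq> \<tau>" "finite \<tau>"
  shows "closed_simplex \<sigma> \<subseteq> closed_simplex \<tau>"
proof
  fix a assume a: "a \<in> closed_simplex \<sigma>"
  then have "(\<Sum>v\<in>\<tau>. a v) = (\<Sum>v\<in>\<sigma>. a v)"
    using assms by (intro sum.mono_neutral_right) (auto simp: closed_simplex_def)
  then show "a \<in> closed_simplex \<tau>"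
    using a assms by (auto simp: closed_simplex_def)
qed

text \<open>No coordinate exceeds the sum 1, so the simplex is a closed subset of a product of unit
  intervals, which is compact by Tychonoff.\<close>

lemma compact_closed_simplex: "compact (closed_simplex \<sigma>)"
proof -
  have "a v \<le> 1" if "a \<in> closed_simplex \<sigma>" for a v
  proof (cases "v \<in> \<sigma>")
    case True
    with that show ?thesis
      using member_le_sum [of v \<sigma> a] closed_simplex_finite [OF that] by (auto simp: closed_simplex_def)
  next
    case False
    with that show ?thesis by (auto simp: closed_simplex_def)
  qed
  then have sub: "closed_simplex \<sigma> \<subseteq> PiE UNIV (\<lambda>_. {0..1})"
    by (auto simp: closed_simplex_def)
  have "compactin (product_topology (\<lambda>_. euclideanreal) UNIV) (PiE UNIV (\<lambda>_ :: 'a. {0..1}))"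
    by (simp add: compactin_PiE)
  then have "compact (PiE UNIV (\<lambda>_ :: 'a. {0..1 :: real}))"
    by (simp add: euclidean_product_topology)
  then show ?thesis
    using compact_Int_closed [OF _ closed_closed_simplex] sub by (metis inf.absorb_iff2)
qed

text \<open>Each closed simplex is closed in the product topology, so relative closedness in it
  becomes plain closedness.\<close>

lemma closedin_realization:
  "closedin (realization \<K>) S \<longleftrightarrow>
    S \<subseteq> (\<Union>\<sigma>\<in>\<K>. closed_simplex \<sigma>) \<and> (\<forall>\<sigma>\<in>\<K>. closed (closed_simplex \<sigma> \<inter> S))"
proof -
  have "openin (top_of_set (closed_simplex \<sigma>)) (closed_simplex \<sigma> \<inter> ((\<Union>\<sigma>\<in>\<K>. closed_simplex \<sigma>) - S)) \<longleftrightarrow>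
      closed (closed_simplex \<sigma> \<inter> S)" if "\<sigma> \<in> \<K>" for \<sigma>
  proof -
    have "closed_simplex \<sigma> \<inter> ((\<Union>\<sigma>\<in>\<K>. closed_simplex \<sigma>) - S) = closed_simplex \<sigma> - closed_simplex \<sigma> \<inter> S"
      using that by blast
    moreover have "openin (top_of_set (closed_simplex \<sigma>)) (closed_simplex \<sigma> - closed_simplex \<sigma> \<inter> S) \<longleftrightarrow>
        closedin (top_of_set (closed_simplex \<sigma>)) (closed_simplex \<sigma> \<inter> S)"
      by (simp add: closedin_def)
    ultimately show ?thesis
      by (metis closed_closed_simplex closedin_closed_eq inf_le1)
  qed
  then show ?thesis
    by (simp add: closedin_def openin_realization realization_open_def topspace_realization)
qed

text \<open>The weak topology is at least as fine as the one induced by the product topology. This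
  makes the barycentric coordinates continuous.\<close>

lemma openin_realization_Int:
  assumes "open W"
  shows "openin (realization \<K>) (topspace (realization \<K>) \<inter> W)"
proof -
  have "closed_simplex \<sigma> \<inter> ((\<Union>\<sigma>\<in>\<K>. closed_simplex \<sigma>) \<inter> W) = closed_simplex \<sigma> \<inter> W" if "\<sigma> \<in> \<K>" for \<sigma>
    using that by blast
  then show ?thesis
    using assms by (simp add: openin_realization realization_open_def topspace_realization openin_open_Int)
qed

lemma subtopology_realization_closed_simplex:
  assumes "\<sigma> \<in> \<K>"
  shows "subtopology (realization \<K>) (closed_simplex \<sigma>) = top_of_set (closed_simplex \<sigma>)"
  unfolding topology_eq
proof (intro allI iffI)
  fix S assume "openin (subtopology (realization \<K>) (closed_simplex \<sigma>)) S"
  then show "openin (top_of_set (closed_simplex \<sigma>)) S"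
    using assms by (auto simp: openin_subtopology openin_realization realization_open_def Int_commute)
next
  fix S assume "openin (top_of_set (closed_simplex \<sigma>)) S"
  then obtain W where W: "open W" "S = closed_simplex \<sigma> \<inter> W"
    by (auto simp: openin_open)
  have "S = topspace (realization \<K>) \<inter> W \<inter> closed_simplex \<sigma>"
    using W assms by (auto simp: topspace_realization)
  then show "openin (subtopology (realization \<K>) (closed_simplex \<sigma>)) S"
    using openin_realization_Int [OF W(1)] by (auto simp: openin_subtopology)
qed

lemma compactin_realization_closed_simplex:
  assumes "\<sigma> \<in> \<K>"
  shows "compactin (realization \<K>) (closed_simplex \<sigma>)"
proof -
  have "closed_simplex \<sigma> \<subseteq> topspace (realization \<K>)"
    using assms by (auto simp: topspace_realization)
  moreover have "compact_space (subtopology (realization \<K>) (closed_simplex \<sigma>))"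
    using compact_closed_simplex [of \<sigma>]
    by (simp add: subtopology_realization_closed_simplex [OF assms] compact_space_subtopology flip: compactin_euclidean_iff)
  ultimately show ?thesis by (simp add: compactin_subspace)
qed

text \<open>Distinct points differ in some coordinate, and disjoint real neighbourhoods pull back
  along that coordinate.\<close>

lemma Hausdorff_space_realization: "Hausdorff_space (realization \<K>)"
  unfolding Hausdorff_space_def
proof (intro allI impI, elim conjE)
  fix a b assume ab: "a \<in> topspace (realization \<K>)" "b \<in> topspace (realization \<K>)" "a \<noteq> b"
  then obtain v where "a v \<noteq> b v" by auto
  then obtain U V where UV: "open U" "open V" "a v \<in> U" "b v \<in> V" "U \<inter> V = {}"
    by (meson hausdorff)
  have op: "open ((\<lambda>a. a v) -` U)" if "open U" for U :: "real set"
    using that by (intro open_vimage continuous_on_product_coordinates)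
  show "\<exists>U V. openin (realization \<K>) U \<and> openin (realization \<K>) V \<and> a \<in> U \<and> b \<in> V \<and> disjnt U V"
    using openin_realization_Int [OF op [OF UV(1)]] openin_realization_Int [OF op [OF UV(2)]] ab UV(3-5)
    by (intro exI [of _ "topspace (realization \<K>) \<inter> (\<lambda>a. a v) -` U"] 
        exI [of _ "topspace (realization \<K>) \<inter> (\<lambda>a. a v) -` V"]) (auto simp: disjnt_def)
qed

text \<open>The closed simplices are among the compact sets, and by definition they already
  determine the weak topology.\<close>

lemma k_space_realization: "k_space (realization \<K>)"
  unfolding k_space
proof (intro allI impI, elim conjE)
  fix S assume S: "S \<subseteq> topspace (realization \<K>)"
    and *: "\<forall>K. compactin (realization \<K>) K \<longrightarrow> closedin (subtopology (realization \<K>) K) (K \<inter> S)"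
  have "closed (closed_simplex \<sigma> \<inter> S)" if "\<sigma> \<in> \<K>" for \<sigma>
    using * [rule_format, OF compactin_realization_closed_simplex [OF that]] closed_closed_simplex
    by (metis subtopology_realization_closed_simplex [OF that] closedin_closed_trans)
  then show "closedin (realization \<K>) S"
    using S by (simp add: closedin_realization topspace_realization)
qed

text \<open>A finite simplex of \<open>\<K>\<close> meets the realization of \<open>\<L>\<close> in
  the union of its finitely many faces in \<open>\<L>\<close>, and \<open>S\<close> is closed in
  each of them.\<close>

lemma closedin_realization_mono:
  assumes "\<L> \<subseteq> \<K>" and face: "\<And>\<sigma> \<tau>. \<sigma> \<in> \<L> \<Longrightarrow> \<tau> \<subseteq> \<sigma> \<Longrightarrow> \<tau> \<noteq> {} \<Longrightarrow> \<tau> \<in> \<L>"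
    and S: "closedin (realization \<L>) S"
  shows "closedin (realization \<K>) S"
  unfolding closedin_realization
proof (intro conjI ballI)
  show "S \<subseteq> (\<Union>\<sigma>\<in>\<K>. closed_simplex \<sigma>)"
    using S assms(1) unfolding closedin_realization by blast
  fix \<tau> assume "\<tau> \<in> \<K>"
  show "closed (closed_simplex \<tau> \<inter> S)"
  proof (cases "finite \<tau>")
    case True
    have "closed_simplex \<tau> \<inter> S = (\<Union>\<rho>\<in>{\<rho>. \<rho> \<subseteq> \<tau> \<and> \<rho> \<in> \<L>}. closed_simplex \<rho> \<inter> S)" (is "?A = ?B")
    proof
      show "?B \<subseteq> ?A" using closed_simplex_mono [OF _ True] by blast
      show "?A \<subseteq> ?B"
      proof
        fix a assume a: "a \<in> ?A"
        then obtain \<sigma> where \<sigma>: "\<sigma> \<in> \<L>" "a \<in> closed_simplex \<sigma>"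
          using S by (auto simp: closedin_realization)
        then have "a \<in> closed_simplex (\<sigma> \<inter> \<tau>)" using a by (simp add: closed_simplex_Int)
        moreover from this have "\<sigma> \<inter> \<tau> \<in> \<L>"
          using closed_simplex_nonempty by (intro face [OF \<sigma>(1)]) auto
        ultimately show "a \<in> ?B" using a by auto
      qed
    qed
    moreover have "closed ?B"
      using True S by (intro closed_UN) (auto simp: closedin_realization)
    ultimately show ?thesis by simp
  next
    case False
    then have "closed_simplex \<tau> = {}" using closed_simplex_finite by blast
    then show ?thesis by simp
  qed
qed

text \<open>One direction extends closed sets by \<open>closedin_realization_mono\<close>. For the
  other, intersecting with the realization of \<open>\<L>\<close> leaves the trace on every simplex
  of \<open>\<L>\<close> unchanged.\<close>

lemma subtopology_realization:
  assumes "\<L> \<subseteq> \<K>" and face: "\<And>\<sigma> \<tau>. \<sigma> \<in> \<L> \<Longrightarrow> \<tau> \<subseteq> \<sigma> \<Longrightarrow> \<tau> \<noteq> {} \<Longrightarrow> \<tau> \<in> \<L>"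
  shows "subtopology (realization \<K>) (topspace (realization \<L>)) = realization \<L>"
proof -
  have top: "topspace (subtopology (realization \<K>) (topspace (realization \<L>))) = topspace (realization \<L>)"
    using assms(1) by (auto simp: topspace_realization)
  have eq: "closedin (subtopology (realization \<K>) (topspace (realization \<L>))) S \<longleftrightarrow> closedin (realization \<L>) S" for S
  proof
    assume "closedin (realization \<L>) S"
    then show "closedin (subtopology (realization \<K>) (topspace (realization \<L>))) S"
      using closedin_realization_mono [OF assms] closedin_subset [of "realization \<L>" S]
      by (intro closedin_subset_topspace) auto
  next
    assume "closedin (subtopology (realization \<K>) (topspace (realization \<L>))) S"
    then obtain T where T: "closedin (realization \<K>) T" "S = T \<inter> topspace (realization \<L>)"
      by (auto simp: closedin_subtopology)
    have "closed (closed_simplex \<sigma> \<inter> S)" if "\<sigma> \<in> \<L>" for \<sigma>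
    proof -
      have "closed_simplex \<sigma> \<inter> S = closed_simplex \<sigma> \<inter> T"
        unfolding T(2) topspace_realization using that by blast
      then show ?thesis
        using T(1) that assms(1) unfolding closedin_realization by auto
    qed
    then show "closedin (realization \<L>) S"
      using T(2) unfolding closedin_realization topspace_realization by blast
  qed
  show ?thesis
    unfolding topology_eq openin_closedin_eq top eq by blast
qed

section \<open>Continuity of maps out of and into realizations\<close>

lemma continuous_map_from_realization:
  assumes "\<And>\<sigma>. \<sigma> \<in> \<K> \<Longrightarrow> continuous_map (top_of_set (closed_simplex \<sigma>)) Y f"
  shows "continuous_map (realization \<K>) Y f"
  unfolding continuous_map_def
proof (intro conjI allI impI)
  show "f \<in> topspace (realization \<K>) \<rightarrow> topspace Y"
    using assms by (fastforce simp: topspace_realization continuous_map_def)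
  fix U assume U: "openin Y U"
  have "openin (top_of_set (closed_simplex \<sigma>)) (closed_simplex \<sigma> \<inter> {a \<in> topspace (realization \<K>). f a \<in> U})"
    if "\<sigma> \<in> \<K>" for \<sigma>
  proof -
    have "closed_simplex \<sigma> \<inter> {a \<in> topspace (realization \<K>). f a \<in> U} = {a \<in> closed_simplex \<sigma>. f a \<in> U}"
      using that by (auto simp: topspace_realization)
    then show ?thesis
      using openin_continuous_map_preimage [OF assms [OF that] U] by simp
  qed
  then show "openin (realization \<K>) {a \<in> topspace (realization \<K>). f a \<in> U}"
    by (auto simp: openin_realization realization_open_def topspace_realization)
qed

lemma continuous_map_into_realization:
  assumes "continuous_on S f" "f ` S \<subseteq> closed_simplex \<sigma>" "\<sigma> \<in> \<K>"
  shows "continuous_map (top_of_set S) (realization \<K>) f"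
proof -
  have "continuous_map (top_of_set S) (top_of_set (closed_simplex \<sigma>)) f"
    using assms(1,2) by (auto simp: continuous_map_subtopology_eu)
  then show ?thesis
    by (simp add: continuous_map_in_subtopology flip: subtopology_realization_closed_simplex [OF assms(3)])
qed

text \<open>By the tube lemma, for a compact \<open>J\<close> the set of all \<open>a\<close> with \<open>h (J \<times> {a}) \<subseteq> U\<close> is open in every
  simplex, hence open.\<close>

lemma continuous_map_from_prod_realization:
  assumes Z: "locally_compact_space Z" "Hausdorff_space Z"
    and h: "\<And>\<sigma>. \<sigma> \<in> \<K> \<Longrightarrow> continuous_map (prod_topology Z (top_of_set (closed_simplex \<sigma>))) Y h"
  shows "continuous_map (prod_topology Z (realization \<K>)) Y h"
  unfolding continuous_map_def
proof (intro conjI allI impI)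
  show "h \<in> topspace (prod_topology Z (realization \<K>)) \<rightarrow> topspace Y"
    using h by (fastforce simp: topspace_realization continuous_map_def)
  fix U assume U: "openin Y U"
  define W where "W = {p \<in> topspace (prod_topology Z (realization \<K>)). h p \<in> U}"
  have open_W: "openin (prod_topology Z (top_of_set (closed_simplex \<sigma>))) 
      {p \<in> topspace Z \<times> closed_simplex \<sigma>. h p \<in> U}" if "\<sigma> \<in> \<K>" for \<sigma>
    using openin_continuous_map_preimage [OF h [OF that] U] by simp
  have nb: "neighbourhood_base_of (compactin Z) Z"
    using Z locally_compact_space_neighbourhood_base by auto
  have "\<exists>A B. openin Z A \<and> openin (realization \<K>) B \<and> t \<in> A \<and> a \<in> B \<and> A \<times> B \<subseteq> W" if "(t, a) \<in> W" for t a
  proof -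
    obtain \<sigma> where \<sigma>: "\<sigma> \<in> \<K>" "a \<in> closed_simplex \<sigma>" and t: "t \<in> topspace Z" and ta: "h (t, a) \<in> U"
      using \<open>(t, a) \<in> W\<close> by (auto simp: W_def topspace_realization)
    \<comment> \<open>The slice through \<open>a\<close> is open in \<open>Z\<close>, so local
      compactness gives a compact neighbourhood \<open>J\<close> of \<open>t\<close> inside
      it.\<close>
    have "openin Z {s \<in> topspace Z. (s, a) \<in> {p \<in> topspace Z \<times> closed_simplex \<sigma>. h p \<in> U}}"
      by (rule openin_continuous_map_preimage [OF _ open_W [OF \<sigma>(1)]])
        (use \<sigma>(2) in \<open>simp add: continuous_map_pairwise o_def\<close>)
    moreover have "t \<in> {s \<in> topspace Z. (s, a) \<in> {p \<in> topspace Z \<times> closed_simplex \<sigma>. h p \<in> U}}"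
      using t ta \<sigma> by simp
    ultimately obtain A J where AJ: "openin Z A" "compactin Z J" "t \<in> A" "A \<subseteq> J"
        "J \<subseteq> {s \<in> topspace Z. (s, a) \<in> {p \<in> topspace Z \<times> closed_simplex \<sigma>. h p \<in> U}}"
      using nb unfolding neighbourhood_base_of by meson
    define B where "B = {b \<in> topspace (realization \<K>). \<forall>s\<in>J. h (s, b) \<in> U}"
    have "openin (top_of_set (closed_simplex \<tau>)) (closed_simplex \<tau> \<inter> B)" if \<tau>: "\<tau> \<in> \<K>" for \<tau>
    proof (subst openin_subopen, intro ballI)
      fix b assume b: "b \<in> closed_simplex \<tau> \<inter> B"
      have "J \<times> {b} \<subseteq> {p \<in> topspace Z \<times> closed_simplex \<tau>. h p \<in> U}"
        using b AJ compactin_subset_topspace by (fastforce simp: B_def)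
      from tube_lemma_left [OF open_W [OF \<tau>] AJ(2) _ this] b
      obtain M N where MN: "openin (top_of_set (closed_simplex \<tau>)) N" "J \<subseteq> M" "b \<in> N"
          "M \<times> N \<subseteq> {p \<in> topspace Z \<times> closed_simplex \<tau>. h p \<in> U}"
        by auto
      have "N \<subseteq> closed_simplex \<tau> \<inter> B"
      proof
        fix c assume "c \<in> N"
        moreover have "N \<subseteq> closed_simplex \<tau>" using openin_subset [OF MN(1)] by simp
        ultimately show "c \<in> closed_simplex \<tau> \<inter> B"
          using MN \<tau> by (auto simp: B_def topspace_realization)
      qed
      then show "\<exists>T. openin (top_of_set (closed_simplex \<tau>)) T \<and> b \<in> T \<and> T \<subseteq> closed_simplex \<tau> \<inter> B"
        using MN by blast
    qed
    then have "openin (realization \<K>) B"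
      by (auto simp: openin_realization realization_open_def B_def topspace_realization)
    moreover have "a \<in> B"
      using AJ \<sigma> by (auto simp: B_def topspace_realization)
    moreover have "A \<times> B \<subseteq> W"
      using AJ openin_subset [OF AJ(1)] by (auto simp: B_def W_def)
    ultimately show ?thesis using AJ by blast
  qed
  then show "openin (prod_topology Z (realization \<K>)) {p \<in> topspace (prod_topology Z (realization \<K>)). h p \<in> U}"
    unfolding W_def [symmetric] openin_prod_topology_alt by blast
qed

section \<open>Simplicial maps and contiguity\<close>

text \<open>Summing over the support frees the formula from any chosen simplex. At points of a
  realization the support is finite.\<close>

definition simplicial_map :: "('v \<Rightarrow> 'w) \<Rightarrow> ('v \<Rightarrow> real) \<Rightarrow> 'w \<Rightarrow> real" where
  "simplicial_map f a w = (\<Sum>v | a v \<noteq> 0 \<and> f v = w. a v)"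

text \<open>The additional terms are 0. On one closed simplex the index set no longer varies with
  \<open>a\<close>, and continuity rests on this.\<close>

lemma simplicial_map_eq:
  assumes "a \<in> closed_simplex \<sigma>"
  shows "simplicial_map f a w = (\<Sum>v | v \<in> \<sigma> \<and> f v = w. a v)"
  unfolding simplicial_map_def using assms closed_simplex_finite [OF assms]
  by (intro sum.mono_neutral_left) (auto simp: closed_simplex_def)

text \<open>The coordinates are regrouped along the fibres of \<open>f\<close>, so the total stays
  1.\<close>

lemma simplicial_map_in_closed_simplex:
  assumes a: "a \<in> closed_simplex \<sigma>"
  shows "simplicial_map f a \<in> closed_simplex (f ` \<sigma>)"
proof -
  have "(\<Sum>w\<in>f ` \<sigma>. simplicial_map f a w) = (\<Sum>v\<in>\<sigma>. a v)"
    by (simp add: simplicial_map_eq [OF a] closed_simplex_finite [OF a] sum.image_gen [of \<sigma> a f])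
  moreover have "simplicial_map f a w = 0" if "w \<notin> f ` \<sigma>" for w
    unfolding simplicial_map_eq [OF a] using that by (intro sum.neutral) auto
  moreover have "0 \<le> simplicial_map f a w" for w
    unfolding simplicial_map_eq [OF a] using a by (intro sum_nonneg) (auto simp: closed_simplex_def)
  ultimately show ?thesis
    using a by (simp add: closed_simplex_def)
qed

text \<open>The fibre of \<open>g \<circ> f\<close> over \<open>u\<close> is the disjoint union of
  the fibres of \<open>f\<close> over those \<open>w\<close> with \<open>g w = u\<close>.\<close>

lemma simplicial_map_compose:
  assumes a: "a \<in> closed_simplex \<sigma>"
  shows "simplicial_map g (simplicial_map f a) = simplicial_map (g \<circ> f) a"
proof
  fix u
  let ?S = "{v \<in> \<sigma>. g (f v) = u}"
  have "simplicial_map g (simplicial_map f a) u = (\<Sum>w | w \<in> f ` \<sigma> \<and> g w = u. simplicial_map f a w)"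
    by (rule simplicial_map_eq [OF simplicial_map_in_closed_simplex [OF a]])
  also have "{w. w \<in> f ` \<sigma> \<and> g w = u} = f ` ?S" by auto
  also have "(\<Sum>w\<in>f ` ?S. simplicial_map f a w) = (\<Sum>w\<in>f ` ?S. \<Sum>v | v \<in> ?S \<and> f v = w. a v)"
    unfolding simplicial_map_eq [OF a] by (intro sum.cong refl) auto
  also have "\<dots> = (\<Sum>v\<in>?S. a v)"
    using closed_simplex_finite [OF a] by (intro sum.image_gen [symmetric]) auto
  finally show "simplicial_map g (simplicial_map f a) u = simplicial_map (g \<circ> f) a u"
    by (simp add: simplicial_map_eq [OF a, of "g \<circ> f"])
qed

lemma simplicial_map_cong:
  assumes "a \<in> closed_simplex \<sigma>" "\<And>v. v \<in> \<sigma> \<Longrightarrow> f v = g v"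
  shows "simplicial_map f a = simplicial_map g a"
  unfolding simplicial_map_eq [OF assms(1)] fun_eq_iff
  using assms(2) by (intro allI sum.cong) auto

lemma simplicial_map_fixes:
  assumes "a \<in> closed_simplex \<sigma>" "\<And>v. v \<in> \<sigma> \<Longrightarrow> f v = v"
  shows "simplicial_map f a = a"
proof
  fix w
  have "simplicial_map f a w = (\<Sum>v | v \<in> \<sigma> \<and> f v = w. a v)"
    by (rule simplicial_map_eq [OF assms(1)])
  also have "{v. v \<in> \<sigma> \<and> f v = w} = \<sigma> \<inter> {w}" using assms(2) by auto
  also have "(\<Sum>v\<in>\<sigma> \<inter> {w}. a v) = a w"
    using assms(1) by (auto simp: closed_simplex_def Int_insert_right)
  finally show "simplicial_map f a w = a w" .
qed

lemma continuous_on_simplicial_map: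
  "continuous_on (closed_simplex \<sigma>) (simplicial_map f)"
proof (rule continuous_on_eq)
  show "continuous_on (closed_simplex \<sigma>) (\<lambda>a w. \<Sum>v | v \<in> \<sigma> \<and> f v = w. a v)"
    by (intro continuous_on_coordinatewise_then_product continuous_on_sum
        continuous_on_subset [OF continuous_on_product_coordinates]) auto
qed (auto simp: simplicial_map_eq)

lemma continuous_map_simplicial_map:
  assumes "\<And>\<sigma>. \<sigma> \<in> \<K> \<Longrightarrow> f ` \<sigma> \<in> \<L>"
  shows "continuous_map (realization \<K>) (realization \<L>) (simplicial_map f)"
  using assms simplicial_map_in_closed_simplex
  by (intro continuous_map_from_realization continuous_map_into_realization [OF continuous_on_simplicial_map]) blast+

lemma continuous_map_realization_mono:
  assumes "\<K> \<subseteq> \<L>"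
  shows "continuous_map (realization \<K>) (realization \<L>) (\<lambda>a. a)"
  using assms by (intro continuous_map_from_realization continuous_map_into_realization) auto

section \<open>Straight-line homotopies between contiguous maps\<close>

definition line_homotopy :: "('v \<Rightarrow> 'v) \<Rightarrow> real \<times> ('v \<Rightarrow> real) \<Rightarrow> 'v \<Rightarrow> real" where
  "line_homotopy h = (\<lambda>(t, a) v. (1 - t) * simplicial_map h a v + t * a v)"

lemma line_homotopy_in_closed_simplex:
  assumes "t \<in> {0..1}" "a \<in> closed_simplex \<sigma>"
  shows "line_homotopy h (t, a) \<in> closed_simplex (\<sigma> \<union> h ` \<sigma>)"
proof -
  have fin: "finite (\<sigma> \<union> h ` \<sigma>)" using closed_simplex_finite [OF assms(2)] by simp
  have a: "a \<in> closed_simplex (\<sigma> \<union> h ` \<sigma>)"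
    using closed_simplex_mono [OF _ fin, of \<sigma>] assms(2) by blast
  have b: "simplicial_map h a \<in> closed_simplex (\<sigma> \<union> h ` \<sigma>)"
    using closed_simplex_mono [OF _ fin, of "h ` \<sigma>"] simplicial_map_in_closed_simplex [OF assms(2)] by blast
  show ?thesis
    using a b assms(1)
    by (simp add: closed_simplex_def line_homotopy_def sum.distrib flip: sum_distrib_left)
qed

text \<open>Continuity may be checked on the product of the interval with one closed simplex. There
  all values stay in a single closed simplex of \<open>\<K>\<close>, so continuity of each
  coordinate suffices.\<close>

lemma continuous_map_line_homotopy:
  assumes "\<And>\<sigma>. \<sigma> \<in> \<K> \<Longrightarrow> \<sigma> \<union> h ` \<sigma> \<in> \<K>"
  shows "continuous_map (prod_topology (top_of_set {0..1}) (realization \<K>)) (realization \<K>) (line_homotopy h)"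
proof (rule continuous_map_from_prod_realization)
  show "Hausdorff_space (top_of_set {0..1::real})"
    by (simp add: Hausdorff_space_subtopology)
  show "locally_compact_space (top_of_set {0..1::real})"
    by (simp add: compact_imp_locally_compact_space compact_space_subtopology)
  fix \<sigma> assume "\<sigma> \<in> \<K>"
  have c: "continuous_on ({0..1} \<times> closed_simplex \<sigma>) (\<lambda>p. simplicial_map h (snd p) v)" for v
    using continuous_on_product_then_coordinatewise [OF continuous_on_simplicial_map, of \<sigma> h v]
    by (rule continuous_on_compose2) (auto intro: continuous_intros)
  have d: "continuous_on ({0..1} \<times> closed_simplex \<sigma>) (\<lambda>p :: real \<times> ('a \<Rightarrow> real). snd p v)" for v
    by (rule continuous_on_compose2 [OF continuous_on_product_coordinates]) (auto intro: continuous_intros)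
  have "continuous_on ({0..1} \<times> closed_simplex \<sigma>) (line_homotopy h)"
    unfolding line_homotopy_def case_prod_beta'
    by (intro continuous_on_coordinatewise_then_product continuous_intros c d)
  then show "continuous_map (prod_topology (top_of_set {0..1}) (top_of_set (closed_simplex \<sigma>))) (realization \<K>) (line_homotopy h)"
    unfolding prod_topology_subtopology_eu
    by (rule continuous_map_into_realization [OF _ _ assms [OF \<open>\<sigma> \<in> \<K>\<close>]])
      (use line_homotopy_in_closed_simplex in blast)
qed

section \<open>Complexes on a correspondence\<close>

definition full_complex :: "'v set \<Rightarrow> 'v set set" where
  "full_complex V = {\<sigma>. finite \<sigma> \<and> \<sigma> \<noteq> {} \<and> \<sigma> \<subseteq> V}"

definition pullback_rips :: "'w set \<Rightarrow> ('w \<Rightarrow> 'v) \<Rightarrow> 'v metric \<Rightarrow> real \<Rightarrow> 'w set set" where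
  "pullback_rips V \<phi> P r = {\<sigma> \<in> full_complex V. \<phi> ` \<sigma> \<in> rips_complex P r}"

text \<open>At points of a realization the support is finite and nonempty, so \<open>Max\<close> is
  meaningful. Halving matches the bound \<open>2 * r\<close> in \<open>rips_complex\<close>.\<close>

definition half_diameter :: "('w \<Rightarrow> 'v) \<Rightarrow> 'v metric \<Rightarrow> ('w \<Rightarrow> real) \<Rightarrow> real" where
  "half_diameter \<phi> P a = Max ((\<lambda>(u, v). mdist P (\<phi> u) (\<phi> v)) ` ({v. a v \<noteq> 0} \<times> {v. a v \<noteq> 0})) / 2"

text \<open>Dropping zero coordinates keeps the sum 1, so the support is the smallest simplex
  carrying \<open>a\<close>.\<close>

lemma closed_simplex_support:
  assumes "a \<in> closed_simplex \<sigma>"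
  shows "{v. a v \<noteq> 0} \<subseteq> \<sigma>" "finite {v. a v \<noteq> 0}" "{v. a v \<noteq> 0} \<noteq> {}" "a \<in> closed_simplex {v. a v \<noteq> 0}"
proof -
  show sub: "{v. a v \<noteq> 0} \<subseteq> \<sigma>" using assms by (auto simp: closed_simplex_def)
  then show "finite {v. a v \<noteq> 0}" using closed_simplex_finite [OF assms] finite_subset by blast
  have "(\<Sum>v | a v \<noteq> 0. a v) = (\<Sum>v\<in>\<sigma>. a v)"
    using sub closed_simplex_finite [OF assms] by (intro sum.mono_neutral_left) auto
  then show *: "a \<in> closed_simplex {v. a v \<noteq> 0}"
    using assms by (auto simp: closed_simplex_def)
  then show "{v. a v \<noteq> 0} \<noteq> {}" by (rule closed_simplex_nonempty)
qed

lemma pullback_rips_face: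
  assumes "\<sigma> \<in> pullback_rips V \<phi> P r" "\<tau> \<subseteq> \<sigma>" "\<tau> \<noteq> {}"
  shows "\<tau> \<in> pullback_rips V \<phi> P r"
proof -
  have "finite \<tau>"
    using assms(1,2) finite_subset by (auto simp: pullback_rips_def full_complex_def)
  with assms show ?thesis
    by (auto simp: pullback_rips_def full_complex_def rips_complex_def subset_iff split: if_splits)
qed

text \<open>Membership in the subcomplex is decided by the support: it carries \<open>a\<close>, and
  it is a face of every simplex that contains \<open>a\<close>.\<close>

lemma half_diameter_le_iff:
  assumes V: "\<phi> ` V \<subseteq> mspace P" and a: "a \<in> topspace (realization (full_complex V))"
  shows "half_diameter \<phi> P a \<le> r \<longleftrightarrow> a \<in> topspace (realization (pullback_rips V \<phi> P r))"
proof -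
  let ?S = "{v. a v \<noteq> 0}"
  obtain \<sigma> where \<sigma>: "\<sigma> \<subseteq> V" "a \<in> closed_simplex \<sigma>"
    using a by (auto simp: topspace_realization full_complex_def)
  note S = closed_simplex_support [OF \<sigma>(2)]
  have SV: "\<phi> ` ?S \<subseteq> mspace P" using S(1) \<sigma>(1) V by blast
  have "half_diameter \<phi> P a \<le> r \<longleftrightarrow>
      Max ((\<lambda>(u, v). mdist P (\<phi> u) (\<phi> v)) ` (?S \<times> ?S)) \<le> 2 * r"
    unfolding half_diameter_def by linarith
  also have "\<dots> \<longleftrightarrow> (\<forall>u\<in>?S. \<forall>v\<in>?S. mdist P (\<phi> u) (\<phi> v) \<le> 2 * r)"
    using S(2,3) by (subst Max_le_iff) auto
  also have "\<dots> \<longleftrightarrow> ?S \<in> pullback_rips V \<phi> P r"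
  proof
    assume *: "\<forall>u\<in>?S. \<forall>v\<in>?S. mdist P (\<phi> u) (\<phi> v) \<le> 2 * r"
    \<comment> \<open>\<open>rips_complex\<close> is empty for negative \<open>r\<close>, so
      nonnegativity must be extracted from the distance of a support vertex to itself.\<close>
    obtain u where "u \<in> ?S" using S(3) by blast
    with * have "0 \<le> 2 * r" using mdist_nonneg [of P "\<phi> u" "\<phi> u"] order_trans by blast
    then show "?S \<in> pullback_rips V \<phi> P r"
      using * S SV \<sigma>(1) by (auto simp: pullback_rips_def full_complex_def rips_complex_def)
  next
    assume "?S \<in> pullback_rips V \<phi> P r"
    then show "\<forall>u\<in>?S. \<forall>v\<in>?S. mdist P (\<phi> u) (\<phi> v) \<le> 2 * r"
      by (auto simp: pullback_rips_def rips_complex_def split: if_splits)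
  qed
  also have "\<dots> \<longleftrightarrow> a \<in> topspace (realization (pullback_rips V \<phi> P r))"
  proof
    assume "?S \<in> pullback_rips V \<phi> P r"
    then show "a \<in> topspace (realization (pullback_rips V \<phi> P r))"
      using S(4) unfolding topspace_realization by blast
  next
    assume "a \<in> topspace (realization (pullback_rips V \<phi> P r))"
    then obtain \<tau> where \<tau>: "\<tau> \<in> pullback_rips V \<phi> P r" "a \<in> closed_simplex \<tau>"
      by (auto simp: topspace_realization)
    then show "?S \<in> pullback_rips V \<phi> P r"
      by (intro pullback_rips_face [OF \<tau>(1)] closed_simplex_support(1,3) [OF \<tau>(2)])
  qed
  finally show ?thesis .
qed

lemma CGWH_realization: "CGWH (realization \<K>)"
  by (intro CGWH_if_Hausdorff_k_space Hausdorff_space_realization k_space_realization)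

lemma rips_complex_mono: "r \<le> s \<Longrightarrow> rips_complex P r \<subseteq> rips_complex P s"
  by (auto simp: rips_complex_def intro: order_trans [where y = "2 * r"])

lemma is_rspace_rips: "is_rspace (rips P)"
  by (simp add: is_rspace_def rips_def CGWH_realization continuous_map_realization_mono rips_complex_mono)

section \<open>Moving a realization to another type of points\<close>

lemma homeomorphic_maps_pullback_inv:
  assumes "inj j"
  shows "homeomorphic_maps X (pullback_topology (j ` topspace X) (inv j) X) j (inv j)"
proof -
  let ?T = "pullback_topology (j ` topspace X) (inv j) X"
  have "continuous_map ?T X (inv j)"
    using continuous_map_pullback [OF continuous_map_id, of "j ` topspace X" "inv j" X]
    by (simp add: o_def id_def)
  moreover have "continuous_map X ?T j"
    by (rule continuous_map_pullback') (use assms in \<open>auto simp: o_def\<close>)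
  ultimately show ?thesis
    using assms by (auto simp: homeomorphic_maps_def topspace_pullback_topology)
qed

text \<open>
  A distance at type \<open>'v \<Rightarrow> real\<close> knows nothing about spaces with points in \<open>'v \<times> 'v \<Rightarrow> real\<close>.  If \<open>'v\<close>
  is finite, \<open>'v \<times> 'v\<close> need not embed in \<open>'v\<close>, so the realization cannot be moved by renaming vertices.
  Only its point set is moved, along an arbitrary injection \<open>j\<close>.
\<close>

definition transported :: "(('w \<Rightarrow> real) \<Rightarrow> 'a) \<Rightarrow> 'w set \<Rightarrow> 'a topology" where
  "transported j V = pullback_topology (j ` topspace (realization (full_complex V))) (inv j) (realization (full_complex V))"

lemma homeomorphic_maps_transported:
  "inj j \<Longrightarrow> homeomorphic_maps (realization (full_complex V)) (transported j V) j (inv j)"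
  unfolding transported_def by (rule homeomorphic_maps_pullback_inv)

lemma homeomorphic_space_CGWH:
  assumes "X homeomorphic_space Y" "Hausdorff_space X" "k_space X"
  shows "Hausdorff_space Y" "k_space Y" "CGWH Y"
  using assms homeomorphic_Hausdorff_space homeomorphic_k_space CGWH_if_Hausdorff_k_space by blast+

lemma CGWH_transported: "inj j \<Longrightarrow> CGWH (transported j V)"
  by (rule homeomorphic_space_CGWH(3) [OF homeomorphic_maps_imp_homeomorphic_space
        [OF homeomorphic_maps_transported] Hausdorff_space_realization k_space_realization])

text \<open>By \<open>half_diameter_le_iff\<close> the sublevel set is the image of a subcomplex,
  whose subspace topology is its own weak topology. The result is a Hausdorff k-space, so
  \<open>k_ify\<close> leaves it unchanged.\<close>

lemma sublevel_transported:
  assumes j: "inj j" and V: "\<phi> ` V \<subseteq> mspace P"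
  shows "homeomorphic_maps (realization (pullback_rips V \<phi> P r))
      (rspc (sublevel (transported j V) (half_diameter \<phi> P \<circ> inv j)) r) j (inv j)"
    and "rspc (sublevel (transported j V) (half_diameter \<phi> P \<circ> inv j)) r =
      subtopology (transported j V) (j ` topspace (realization (pullback_rips V \<phi> P r)))"
proof -
  let ?F = "realization (full_complex V)" and ?R = "realization (pullback_rips V \<phi> P r)" and ?T = "transported j V"
  have sub: "pullback_rips V \<phi> P r \<subseteq> full_complex V"
    by (auto simp: pullback_rips_def)
  then have top: "topspace ?R \<subseteq> topspace ?F"
    by (auto simp: topspace_realization)
  have R: "subtopology ?F (topspace ?R) = ?R"
    by (rule subtopology_realization [OF sub pullback_rips_face])
  have topT: "topspace ?T = j ` topspace ?F"
    using homeomorphic_imp_surjective_map homeomorphic_maps_map homeomorphic_maps_transported [OF j] by blast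
  have "homeomorphic_maps (subtopology ?F (topspace ?R)) (subtopology ?T (j ` topspace ?R)) j (inv j)"
    by (rule homeomorphic_maps_subtopologies [OF homeomorphic_maps_transported [OF j]])
      (use top topT in blast)
  then have h: "homeomorphic_maps ?R (subtopology ?T (j ` topspace ?R)) j (inv j)"
    by (simp add: R)
  have set: "{x \<in> topspace ?T. (half_diameter \<phi> P \<circ> inv j) x \<le> r} = j ` topspace ?R"
    using j top half_diameter_le_iff [OF V, of _ r] by (auto simp: topT)
  have "?R homeomorphic_space subtopology ?T (j ` topspace ?R)"
    using h by (rule homeomorphic_maps_imp_homeomorphic_space)
  from homeomorphic_space_CGWH [OF this Hausdorff_space_realization k_space_realization]
  show eq: "rspc (sublevel ?T (half_diameter \<phi> P \<circ> inv j)) r = subtopology ?T (j ` topspace ?R)"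
    using set by (simp add: sublevel_def k_ify_eq)
  show "homeomorphic_maps ?R (rspc (sublevel ?T (half_diameter \<phi> P \<circ> inv j)) r) j (inv j)"
    unfolding eq by (rule h)
qed

lemma rmap_sublevel: "rmap (sublevel T \<gamma>) r s = (\<lambda>x. x)"
  by (simp add: sublevel_def)

lemma is_rspace_sublevel_transported:
  assumes j: "inj j" and V: "\<phi> ` V \<subseteq> mspace P"
  shows "is_rspace (sublevel (transported j V) (half_diameter \<phi> P \<circ> inv j))" (is "is_rspace ?S")
  unfolding is_rspace_def
proof (intro conjI allI impI)
  show "CGWH (rspc ?S r)" for r
    by (rule homeomorphic_space_CGWH(3) [OF homeomorphic_maps_imp_homeomorphic_space
          [OF sublevel_transported(1) [OF assms]] Hausdorff_space_realization k_space_realization])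
  fix r s :: real assume "r \<le> s"
  then have "topspace (realization (pullback_rips V \<phi> P r)) \<subseteq> topspace (realization (pullback_rips V \<phi> P s))"
    using rips_complex_mono [of r s P] unfolding topspace_realization
    by (intro UN_mono) (auto simp: pullback_rips_def)
  then have "continuous_map (rspc ?S r) (rspc ?S s) (\<lambda>x. x)"
    unfolding sublevel_transported(2) [OF assms]
    by (intro continuous_map_into_subtopology continuous_map_from_subtopology) auto
  moreover have "rmap ?S r s = (\<lambda>x. x)" by (rule rmap_sublevel)
  ultimately show "continuous_map (rspc ?S r) (rspc ?S s) (rmap ?S r s)" by simp
qed (unfold rmap_sublevel, simp_all)

section \<open>Comparison with the Vietoris--Rips filtration\<close>

lemma weakly_equivalent_step_rips:
  assumes j: "inj j" and V: "\<phi> ` V = mspace P"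
  shows "weakly_equivalent_step (rips P) (sublevel (transported j V) (half_diameter \<phi> P \<circ> inv j))"
    (is "weakly_equivalent_step _ ?S")
proof -
  \<comment> \<open>The section \<open>s\<close> is fixed before \<open>r\<close>, so one map
    \<open>?f\<close> serves every level and commutes with the inclusions.\<close>
  have "\<forall>p\<in>mspace P. \<exists>v. v \<in> V \<and> \<phi> v = p" by (auto simp flip: V)
  then obtain s where s: "\<And>p. p \<in> mspace P \<Longrightarrow> s p \<in> V" "\<And>p. p \<in> mspace P \<Longrightarrow> \<phi> (s p) = p"
    by metis
  have VP: "\<phi> ` V \<subseteq> mspace P" using V by simp
  let ?f = "j \<circ> simplicial_map s"
  have "weak_homotopy_equivalence (rspc (rips P) r) (rspc ?S r) ?f" for r
  proof -
    let ?R = "rips_complex P r" and ?K = "pullback_rips V \<phi> P r"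
    have R: "\<sigma> \<subseteq> mspace P" "finite \<sigma>" "\<sigma> \<noteq> {}" if "\<sigma> \<in> ?R" for \<sigma>
      using that by (auto simp: rips_complex_def split: if_splits)
    have \<phi>s: "\<phi> ` s ` \<sigma> = \<sigma>" if "\<sigma> \<subseteq> mspace P" for \<sigma>
      using that s by (force simp: image_image)
    have K: "\<phi> ` \<sigma> \<in> ?R" if "\<sigma> \<in> ?K" for \<sigma>
      using that by (simp add: pullback_rips_def)
    have sR: "s ` \<sigma> \<in> ?K" if "\<sigma> \<in> ?R" for \<sigma>
      using R [OF that] s(1) that by (auto simp: pullback_rips_def full_complex_def \<phi>s)
    \<comment> \<open>Contiguity: adding the vertices \<open>s (\<phi> v)\<close> does not change
      the projection to \<open>P\<close>.\<close>
    have h: "\<sigma> \<union> (s \<circ> \<phi>) ` \<sigma> \<in> ?K" if "\<sigma> \<in> ?K" for \<sigma>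
    proof -
      have "\<phi> ` (\<sigma> \<union> (s \<circ> \<phi>) ` \<sigma>) = \<phi> ` \<sigma>"
        using \<phi>s [OF R(1) [OF K [OF that]]] by (simp add: image_Un image_comp)
      then show ?thesis
        using that sR [OF K [OF that]] by (simp add: pullback_rips_def full_complex_def image_comp)
    qed
    have hom: "homeomorphic_maps (realization ?K) (rspc ?S r) j (inv j)"
      by (rule sublevel_transported(1) [OF j VP])
    then have cj: "continuous_map (realization ?K) (rspc ?S r) j"
      and ci: "continuous_map (rspc ?S r) (realization ?K) (inv j)"
      and ji: "\<And>y. y \<in> topspace (rspc ?S r) \<Longrightarrow> j (inv j y) = y"
      by (auto simp: homeomorphic_maps_def)
    have iin: "inv j y \<in> topspace (realization ?K)" if "y \<in> topspace (rspc ?S r)" for y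
      using ci that by (simp add: continuous_map_def Pi_iff)
    have "weak_homotopy_equivalence (realization ?R) (rspc ?S r) ?f"
    proof (rule weak_homotopy_equivalence_strong_deformation_retract)
      show "continuous_map (realization ?R) (rspc ?S r) ?f"
        by (intro continuous_map_compose [OF continuous_map_simplicial_map cj] sR)
      show "continuous_map (rspc ?S r) (realization ?R) (simplicial_map \<phi> \<circ> inv j)"
        by (intro continuous_map_compose [OF ci continuous_map_simplicial_map] K)
      show "(simplicial_map \<phi> \<circ> inv j) (?f a) = a" if a: "a \<in> topspace (realization ?R)" for a
      proof -
        obtain \<sigma> where \<sigma>: "\<sigma> \<in> ?R" "a \<in> closed_simplex \<sigma>"
          using a by (auto simp: topspace_realization)
        have "simplicial_map (\<phi> \<circ> s) a = a"
          using R(1) [OF \<sigma>(1)] s(2) by (intro simplicial_map_fixes [OF \<sigma>(2)]) auto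
        then show ?thesis
          by (simp add: j simplicial_map_compose [OF \<sigma>(2)])
      qed
      \<comment> \<open>The line homotopy lives on the original realization and is conjugated by
        \<open>j\<close>.\<close>
      let ?H = "j \<circ> line_homotopy (s \<circ> \<phi>) \<circ> (\<lambda>(t, y). (t, inv j y))"
      have "continuous_map (prod_topology (top_of_set {0..1::real}) (rspc ?S r))
          (prod_topology (top_of_set {0..1}) (realization ?K)) (\<lambda>(t, y). (t, inv j y))"
        using continuous_map_compose [OF continuous_map_snd ci]
        by (simp add: continuous_map_pairwise o_def case_prod_beta' continuous_map_fst)
      from continuous_map_compose [OF this continuous_map_compose [OF continuous_map_line_homotopy [OF h] cj]]
      show "continuous_map (prod_topology (top_of_set {0..1}) (rspc ?S r)) (rspc ?S r) ?H" .
      show "?H (1, y) = y" if "y \<in> topspace (rspc ?S r)" for y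
        using ji [OF that] by (simp add: line_homotopy_def)
      show "?H (0, y) = ?f ((simplicial_map \<phi> \<circ> inv j) y)" if y: "y \<in> topspace (rspc ?S r)" for y
      proof -
        obtain \<sigma> where "inv j y \<in> closed_simplex \<sigma>"
          using iin [OF y] by (auto simp: topspace_realization)
        then show ?thesis by (simp add: line_homotopy_def simplicial_map_compose)
      qed
      show "?H (t, ?f a) = ?f a" if a: "a \<in> topspace (realization ?R)" for t a
      proof -
        obtain \<sigma> where \<sigma>: "\<sigma> \<in> ?R" "a \<in> closed_simplex \<sigma>"
          using a by (auto simp: topspace_realization)
        \<comment> \<open>As \<open>\<phi> (s p) = p\<close>, both ends of the line agree at points
          in the image of \<open>?f\<close>, so the homotopy is constant there.\<close>
        have "simplicial_map (s \<circ> \<phi> \<circ> s) a = simplicial_map s a"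
          using R(1) [OF \<sigma>(1)] s(2) by (intro simplicial_map_cong [OF \<sigma>(2)]) auto
        then have "simplicial_map (s \<circ> \<phi>) (simplicial_map s a) = simplicial_map s a"
          by (simp add: simplicial_map_compose [OF \<sigma>(2)])
        then show ?thesis
          by (simp add: j line_homotopy_def fun_eq_iff algebra_simps)
      qed
    qed
    then show ?thesis by (simp add: rips_def)
  qed
  moreover from this have "nat_trans (rips P) ?S (\<lambda>r. ?f)"
    unfolding nat_trans_def weak_homotopy_equivalence_def by (simp add: rips_def sublevel_def)
  ultimately show ?thesis
    unfolding weakly_equivalent_step_def
    using is_rspace_rips is_rspace_sublevel_transported [OF j VP] by blast
qed

section \<open>Comparison of two half diameters\<close>

lemma half_diameter_ge:
  assumes "a \<in> closed_simplex \<sigma>" "a u \<noteq> 0" "a v \<noteq> 0"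
  shows "mdist P (\<phi> u) (\<phi> v) / 2 \<le> half_diameter \<phi> P a"
proof -
  have "mdist P (\<phi> u) (\<phi> v) \<le> Max ((\<lambda>(u, v). mdist P (\<phi> u) (\<phi> v)) ` ({v. a v \<noteq> 0} \<times> {v. a v \<noteq> 0}))"
    using assms(2,3) closed_simplex_support(2) [OF assms(1)]
    by (intro Max_ge finite_imageI finite_cartesian_product) force+
  then show ?thesis by (simp add: half_diameter_def)
qed

lemma half_diameter_attained:
  assumes "a \<in> closed_simplex \<sigma>"
  obtains u v where "a u \<noteq> 0" "a v \<noteq> 0" "half_diameter \<phi> P a = mdist P (\<phi> u) (\<phi> v) / 2"
proof -
  have "Max ((\<lambda>(u, v). mdist P (\<phi> u) (\<phi> v)) ` ({v. a v \<noteq> 0} \<times> {v. a v \<noteq> 0}))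
      \<in> (\<lambda>(u, v). mdist P (\<phi> u) (\<phi> v)) ` ({v. a v \<noteq> 0} \<times> {v. a v \<noteq> 0})"
    using closed_simplex_support(2,3) [OF assms] by (intro Max_in) auto
  then show thesis using that unfolding half_diameter_def by auto
qed

text \<open>Take a pair of support vertices at which the larger half diameter is attained. The
  smaller one is at least half the other distance of the same pair.\<close>

lemma half_diameter_diff:
  assumes "a \<in> topspace (realization (full_complex V))"
  obtains u v where "u \<in> V" "v \<in> V" 
    "\<bar>half_diameter \<phi> P a - half_diameter \<psi> Q a\<bar> \<le> \<bar>mdist P (\<phi> u) (\<phi> v) - mdist Q (\<psi> u) (\<psi> v)\<bar> / 2"
proof -
  obtain \<sigma> where \<sigma>: "\<sigma> \<subseteq> V" "a \<in> closed_simplex \<sigma>"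
    using assms by (auto simp: topspace_realization full_complex_def)
  have inV: "v \<in> V" if "a v \<noteq> 0" for v
    using that closed_simplex_support(1) [OF \<sigma>(2)] \<sigma>(1) by blast
  obtain u v where uv: "a u \<noteq> 0" "a v \<noteq> 0" "half_diameter \<phi> P a = mdist P (\<phi> u) (\<phi> v) / 2"
    using half_diameter_attained [OF \<sigma>(2)] by blast
  obtain u' v' where uv': "a u' \<noteq> 0" "a v' \<noteq> 0" "half_diameter \<psi> Q a = mdist Q (\<psi> u') (\<psi> v') / 2"
    using half_diameter_attained [OF \<sigma>(2)] by blast
  show thesis
  proof (cases "half_diameter \<psi> Q a \<le> half_diameter \<phi> P a")
    case True
    then show thesis
      using uv(3) half_diameter_ge [OF \<sigma>(2) uv(1,2), of Q \<psi>]
        abs_ge_self [of "mdist P (\<phi> u) (\<phi> v) - mdist Q (\<psi> u) (\<psi> v)"]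
      by (intro that [of u v] inV uv(1,2)) simp
  next
    case False
    then show thesis
      using uv'(3) half_diameter_ge [OF \<sigma>(2) uv'(1,2), of P \<phi>]
        abs_ge_minus_self [of "mdist P (\<phi> u') (\<phi> v') - mdist Q (\<psi> u') (\<psi> v')"]
      by (intro that [of u' v'] inV uv'(1,2)) (simp add: abs_of_nonpos)
  qed
qed

text \<open>A real is a set of naturals, so a real function on \<open>'v\<close> is a subset of the infinite type \<open>'v \<times> nat\<close>.\<close>

lemma ex_inj_pair_coordinates: "\<exists>j :: ('v \<times> 'v \<Rightarrow> real) \<Rightarrow> 'v \<Rightarrow> real. inj j"
proof -
  have "infinite (UNIV :: ('v \<times> nat) set)"
    by (simp add: finite_prod)
  from card_of_ordIso [THEN iffD2, OF card_of_Times_same_infinite [OF this]]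
  obtain i :: "('v \<times> nat) \<times> ('v \<times> nat) \<Rightarrow> 'v \<times> nat" where i: "inj i"
    by (auto simp: bij_betw_def)
  \<comment> \<open>The entry \<open>((u, v), n)\<close> is regrouped as a pair of elements of
    \<open>'v \<times> nat\<close>, where 0 pads the first one, and \<open>i\<close> codes that
    pair.\<close>
  define k where "k = (\<lambda>((u, v), n). i ((u, 0), (v, n)))"
  have k: "inj k" using i by (auto simp: inj_def k_def)
  obtain b :: "nat set \<Rightarrow> real" where b: "bij b"
    using nat_sets_eqpoll_reals by (auto simp: eqpoll_def)
  \<comment> \<open>Each real \<open>F w\<close> is read as a set of naturals, and \<open>F\<close>
    becomes the coded set of all \<open>(w, n)\<close> with \<open>n\<close> in the set of
    \<open>w\<close>.\<close>
  define A where "A = (\<lambda>F :: 'v \<times> 'v \<Rightarrow> real. k ` {(w, n). n \<in> inv b (F w)})"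
  have "inj A"
  proof (rule injI)
    fix F G assume "A F = A G"
    then have "{(w, n). n \<in> inv b (F w)} = {(w, n). n \<in> inv b (G w)}"
      using k by (simp add: A_def inj_image_eq_iff)
    then have "inv b (F w) = inv b (G w)" for w
      by (cases w) (simp add: set_eq_iff)
    then show "F = G"
      using b by (metis bij_inv_eq_iff ext)
  qed
  \<comment> \<open>Conversely, a subset of \<open>'v \<times> nat\<close> is cut into its sections
    over \<open>v\<close>, each turned into a real by \<open>b\<close>.\<close>
  moreover have "inj (\<lambda>(X :: ('v \<times> nat) set) v. b {n. (v, n) \<in> X})"
  proof (rule injI)
    fix X Y :: "('v \<times> nat) set"
    assume "(\<lambda>v. b {n. (v, n) \<in> X}) = (\<lambda>v. b {n. (v, n) \<in> Y})"
    then have "{n. (v, n) \<in> X} = {n. (v, n) \<in> Y}" for v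
      using b by (metis bij_is_inj injD)
    then show "X = Y" by (auto simp: set_eq_iff)
  qed
  ultimately show ?thesis using inj_compose by blast
qed

theorem proposition1p9:
  fixes d :: "('v \<Rightarrow> real) rspace \<Rightarrow> ('v \<Rightarrow> real) rspace \<Rightarrow> ennreal"
  assumes "rspace_distance d" and "stable_distance d" and "homotopy_invariant d"
  shows "\<forall>P Q :: 'v metric. d (rips P) (rips Q) \<le> d_GH P Q"
proof (intro allI)
  fix P Q :: "'v metric"
  obtain j :: "('v \<times> 'v \<Rightarrow> real) \<Rightarrow> 'v \<Rightarrow> real" where j: "inj j"
    using ex_inj_pair_coordinates by blast
  have "d (rips P) (rips Q) \<le> (SUP ((p, q), (p', q'))\<in>C \<times> C. ennreal \<bar>mdist P p p' - mdist Q q q'\<bar>) / 2"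
    (is "_ \<le> ?D / 2")
    if C: "C \<in> correspondences (mspace P) (mspace Q)" for C
  proof -
    let ?T = "transported j C" and ?\<gamma> = "half_diameter fst P \<circ> inv j" and ?\<kappa> = "half_diameter snd Q \<circ> inv j"
    have C1: "fst ` C = mspace P" and C2: "snd ` C = mspace Q"
      using C by (auto simp: correspondences_def)
    have rs: "is_rspace (rips P)" "is_rspace (rips Q)" "is_rspace (sublevel ?T ?\<gamma>)" "is_rspace (sublevel ?T ?\<kappa>)"
      using C1 C2 by (intro is_rspace_rips is_rspace_sublevel_transported [OF j] equalityD1; simp)+
    have P0: "d (rips P) (sublevel ?T ?\<gamma>) = 0"
      using assms(3) rs weakly_equivalent_step_rips [OF j C1]
      unfolding homotopy_invariant_def weakly_equivalent_def by blast
    have "d (rips Q) (sublevel ?T ?\<kappa>) = 0"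
      using assms(3) rs weakly_equivalent_step_rips [OF j C2]
      unfolding homotopy_invariant_def weakly_equivalent_def by blast
    then have Q0: "d (sublevel ?T ?\<kappa>) (rips Q) = 0"
      using assms(1) rs unfolding rspace_distance_def by metis
    have tri: "d X Z \<le> d X Y + d Y Z" if "is_rspace X" "is_rspace Y" "is_rspace Z" for X Y Z
      using assms(1) that unfolding rspace_distance_def by blast
    \<comment> \<open>Two triangle inequalities pass through the sublevel filtrations, and the outer
      terms vanish by homotopy invariance.\<close>
    have "d (rips P) (rips Q) \<le> d (sublevel ?T ?\<gamma>) (sublevel ?T ?\<kappa>)"
      using tri [OF rs(1,3,2)] tri [OF rs(3,4,2)] P0 Q0 by simp
    also have "\<dots> \<le> sup_dist ?T ?\<gamma> ?\<kappa>"
      using assms(2) CGWH_transported [OF j] unfolding stable_distance_def by blast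
    also have "\<dots> \<le> ?D / 2"
      unfolding sup_dist_def
    proof (rule SUP_least)
      fix x assume "x \<in> topspace ?T"
      then have "inv j x \<in> topspace (realization (full_complex C))"
        using homeomorphic_maps_transported [OF j, of C] by (auto simp: homeomorphic_maps_def continuous_map_def)
      then obtain u v where uv: "u \<in> C" "v \<in> C"
        "\<bar>half_diameter fst P (inv j x) - half_diameter snd Q (inv j x)\<bar> \<le>
          \<bar>mdist P (fst u) (fst v) - mdist Q (snd u) (snd v)\<bar> / 2"
        by (rule half_diameter_diff)
      have "ennreal \<bar>?\<gamma> x - ?\<kappa> x\<bar> \<le> ennreal (\<bar>mdist P (fst u) (fst v) - mdist Q (snd u) (snd v)\<bar> / 2)"
        using uv(3) by (intro ennreal_leI) simp
      also have "\<dots> = ennreal \<bar>mdist P (fst u) (fst v) - mdist Q (snd u) (snd v)\<bar> / 2"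
        by (simp add: ennreal_divide_numeral)
      \<comment> \<open>\<open>u\<close> and \<open>v\<close> are themselves pairs in
        \<open>C\<close>, so \<open>(u, v)\<close> indexes one term of the distortion.\<close>
      also have "\<dots> \<le> ?D / 2"
        using uv(1,2) by (intro divide_right_mono_ennreal SUP_upper2 [of "(u, v)"]) (auto simp: case_prod_unfold)
      finally show "ennreal \<bar>?\<gamma> x - ?\<kappa> x\<bar> \<le> ?D / 2" .
    qed
    finally show ?thesis .
  qed
  \<comment> \<open>The factor 2 is cleared before taking the infimum over \<open>C\<close> and
    divided out afterwards. If there is no correspondence, the infimum is top.\<close>
  then have "d (rips P) (rips Q) * 2 \<le> (SUP ((p, q), (p', q'))\<in>C \<times> C. ennreal \<bar>mdist P p p' - mdist Q q q'\<bar>)"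
    if "C \<in> correspondences (mspace P) (mspace Q)" for C
    using mult_right_mono [OF _ zero_le, of _ _ "2 :: ennreal"] that
    by (fastforce simp: ennreal_divide_times)
  then have "d (rips P) (rips Q) * 2 \<le> (INF C\<in>correspondences (mspace P) (mspace Q).
      SUP ((p, q), (p', q'))\<in>C \<times> C. ennreal \<bar>mdist P p p' - mdist Q q q'\<bar>)"
    by (rule INF_greatest)
  from divide_right_mono_ennreal [OF this, of 2]
  show "d (rips P) (rips Q) \<le> d_GH P Q"
    unfolding d_GH_def by (simp add: mult_divide_eq_ennreal)
qed

end
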